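(* There exists a universal constant $C>0$ such that for all $\gamma\in(0,1)$, all integers $n,d\ge1$, all $p_0\in\mathcal{P}_d$, all $\alpha\in(0,1]$ and every nonempty $B\subseteq[d]$, \[ \mathcal{E}_{n,\alpha}(p_0,\mathbb{L}_1)\le C\max\biggl\{\frac{|B|^{1/2}}{(n\alpha^2\gamma^2)^{1/2}},\;p_0(B^c)\biggr\}\qquad\text{and}\qquad \mathcal{E}_{n,\alpha}(p_0,\mathbb{L}_2)\le\frac{C}{(n\alpha^2\gamma^2)^{1/2}}, \] where $B^c=[d]\setminus B$ and $p_0(B^c)=\sum_{j\in B^c}p_0(j)$. In particular, let \[ \tilde j=\min\Bigl\{j=1,\dots,d:\frac{j^{1/2}}{(n\alpha^2)^{1/2}}\ge\sum_{j'=j+1}^d p_0(j')\Bigr\}. \] Then for every $\gamma\in(0,1)$ there exists $C_1=C_1(\gamma)$, depending only on $\gamma$, such that for all $n,d\ge 1$, $p_0\in\mathcal{P}_d$ and $\alpha\in(0,1]$, \[ \mathcal{E}_{n,\alpha}(p_0,\mathbb{L}_1)\le C_1\frac{\tilde j^{1/2}}{(n\alpha^2)^{1/2}}. \]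
   Context: $[d]=\{1,\dots,d\}$ and $\mathcal{P}_d=\{p\in[0,1]^d:\sum_{j=1}^d p(j)=1\}$. Data $X_1,\dots,X_n$ are i.i.d. with $\mathbb{P}(X_i=j)=p(j)$ for an unknown $p\in\mathcal{P}_d$. For $r\in\{1,2\}$ let $\|\cdot\|_r$ be the $\ell_r$ norm on $\mathbb{R}^d$ and, for $\delta>0$, $H_1(\delta,\mathbb{L}_r)=\{p\in\mathcal{P}_d:\|p-p_0\|_r\ge\delta\}$; the null hypothesis is $p=p_0$. A (sequentially interactive) $\alpha$-LDP privacy mechanism $Q$ generates private data $Z_1,\dots,Z_n$ in a measurable space $\mathcal{Z}$ successively, where $Z_i$ is drawn from a conditional distribution (Markov kernel) $Q_i(\cdot\mid x_i,z_1,\dots,z_{i-1})$ given $X_i=x_i$ and $Z_1=z_1,\dots,Z_{i-1}=z_{i-1}$, with \[ Q_i(A\mid x,z_1,\dots,z_{i-1})\le e^{\alpha}\,Q_i(A\mid x',z_1,\dots,z_{i-1}) \] for all measurable $A$, all $z_1,\dots,z_{i-1}$, all $x,x'\in[d]$ and all $i=1,\dots,n$. The set of $\alpha$-LDP mechanisms is $\mathcal{Q}_\alpha$. A test is a measurable map $\phi:\mathcal{Z}^n\to[0,1]$ of $(Z_1,\dots,Z_n)$; $\Phi_Q$ is the set of tests, and $\mathbb{E}_p$ denotes expectation when the $X_i$ are i.i.d. from $p$ and privatized by $Q$. Risks and radii (with $\sup\emptyset=0$): \[ \mathcal{R}_n(p_0,\delta,Q,\mathbb{L}_r)=\inf_{\phi\in\Phi_Q}\sup_{p\in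 H_1(\delta,\mathbb{L}_r)}\{\mathbb{E}_{p_0}(\phi)+\mathbb{E}_p(1-\phi)\}, \] $\mathcal{R}_{n,\alpha}(p_0,\delta,\mathbb{L}_r)=\inf_{Q\in\mathcal{Q}_\alpha}\mathcal{R}_n(p_0,\delta,Q,\mathbb{L}_r)$, and, for the fixed level $\gamma\in(0,1)$, $\mathcal{E}_{n,\alpha}(p_0,\mathbb{L}_r)=\inf\{\delta>0:\mathcal{R}_{n,\alpha}(p_0,\delta,\mathbb{L}_r)\le\gamma\}$. *)

theory Defs
  imports "HOL-Probability.Probability"
begin

definition prob_vectors :: "nat \<Rightarrow> (nat \<Rightarrow> real) set" where
  "prob_vectors d = {p \<in> {1..d} \<rightarrow>\<^sub>E {0..1}. (\<Sum>j=1..d. p j) = 1}"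

definition lnorm :: "nat \<Rightarrow> nat \<Rightarrow> (nat \<Rightarrow> real) \<Rightarrow> real" where
  "lnorm r d v = root r (\<Sum>j=1..d. \<bar>v j\<bar> ^ r)"

definition alternatives :: "nat \<Rightarrow> nat \<Rightarrow> (nat \<Rightarrow> real) \<Rightarrow> real \<Rightarrow> (nat \<Rightarrow> real) set" where
  "alternatives r d p0 \<delta> = {p \<in> prob_vectors d. lnorm r d (\<lambda>j. p j - p0 j) \<ge> \<delta>}"

text \<open>
  \<open>Q i x z\<close> is the conditional law of the \<open>i\<close>-th private datum (\<open>i = 1, ..., n\<close>) given that the
  \<open>i\<close>-th raw datum is \<open>x\<close> and that the earlier private data are \<open>z 1, ..., z (i - 1)\<close>.
  Of the measure \<open>Z\<close> only the underlying measurable space is used.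
\<close>

type_synonym 'z mechanism = "nat \<Rightarrow> nat \<Rightarrow> (nat \<Rightarrow> 'z) \<Rightarrow> 'z measure"

definition ldp_mechanism :: "nat \<Rightarrow> nat \<Rightarrow> real \<Rightarrow> 'z measure \<Rightarrow> 'z mechanism \<Rightarrow> bool" where
  "ldp_mechanism n d \<alpha> Z Q \<longleftrightarrow>
    (\<forall>i\<in>{1..n}.
      (\<lambda>(x, z). Q i x z)
        \<in> count_space {1..d} \<Otimes>\<^sub>M Pi\<^sub>M {1..<i} (\<lambda>_. Z) \<rightarrow>\<^sub>M prob_algebra Z \<and>
      (\<forall>A\<in>sets Z. \<forall>z\<in>space (Pi\<^sub>M {1..<i} (\<lambda>_. Z)). \<forall>x\<in>{1..d}. \<forall>x'\<in>{1..d}.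
        measure (Q i x z) A \<le> exp \<alpha> * measure (Q i x' z) A))"

text \<open>The law of \<open>(Z\<^sub>1, ..., Z\<^sub>k)\<close> conditionally on the raw data \<open>x 1, ..., x k\<close>.\<close>

primrec private_law_given ::
  "'z measure \<Rightarrow> 'z mechanism \<Rightarrow> (nat \<Rightarrow> nat) \<Rightarrow> nat \<Rightarrow> (nat \<Rightarrow> 'z) measure" where
  "private_law_given Z Q x 0 = return (Pi\<^sub>M {} (\<lambda>_. Z)) (\<lambda>_. undefined)"
| "private_law_given Z Q x (Suc k) =
    private_law_given Z Q x k \<bind>
      (\<lambda>z. distr (Q (Suc k) (x (Suc k)) z) (Pi\<^sub>M {1..Suc k} (\<lambda>_. Z)) (\<lambda>y. z(Suc k := y)))"

definition data_law :: "nat \<Rightarrow> nat \<Rightarrow> (nat \<Rightarrow> real) \<Rightarrow> (nat \<Rightarrow> nat) measure" where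
  "data_law n d p = Pi\<^sub>M {1..n} (\<lambda>_. point_measure {1..d} (\<lambda>j. ennreal (p j)))"

definition private_law ::
  "nat \<Rightarrow> nat \<Rightarrow> 'z measure \<Rightarrow> 'z mechanism \<Rightarrow> (nat \<Rightarrow> real) \<Rightarrow> (nat \<Rightarrow> 'z) measure" where
  "private_law n d Z Q p = data_law n d p \<bind> (\<lambda>x. private_law_given Z Q x n)"

definition private_tests :: "nat \<Rightarrow> 'z measure \<Rightarrow> ((nat \<Rightarrow> 'z) \<Rightarrow> real) set" where
  "private_tests n Z =
    {\<phi> \<in> borel_measurable (Pi\<^sub>M {1..n} (\<lambda>_. Z)).
      \<forall>z\<in>space (Pi\<^sub>M {1..n} (\<lambda>_. Z)). \<phi> z \<in> {0..1}}"

text \<open>Risks are nonnegative; taking them in \<^typ>\<open>ennreal\<close> makes the supremum over an empty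
  set of alternatives equal to \<open>0\<close>.\<close>

definition mechanism_risk ::
  "nat \<Rightarrow> nat \<Rightarrow> nat \<Rightarrow> (nat \<Rightarrow> real) \<Rightarrow> real \<Rightarrow> 'z measure \<Rightarrow> 'z mechanism \<Rightarrow> ennreal" where
  "mechanism_risk r n d p0 \<delta> Z Q =
    (INF \<phi>\<in>private_tests n Z. SUP p\<in>alternatives r d p0 \<delta>.
      ennreal ((\<integral>z. \<phi> z \<partial>private_law n d Z Q p0) + (\<integral>z. 1 - \<phi> z \<partial>private_law n d Z Q p)))"

text \<open>
  A type cannot be quantified over, so the private data are taken in an arbitrary measurable space
  whose points are real numbers; up to isomorphism this includes every standard Borel space.
  Admitting further spaces could only decrease the infimum, hence only decrease
  \<open>testing_radius\<close>: upper bounds on the latter remain valid for any larger class.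
\<close>

definition private_risk ::
  "nat \<Rightarrow> nat \<Rightarrow> nat \<Rightarrow> real \<Rightarrow> (nat \<Rightarrow> real) \<Rightarrow> real \<Rightarrow> ennreal" where
  "private_risk r n d \<alpha> p0 \<delta> =
    (INF (Z, Q)\<in>{(Z :: real measure, Q). ldp_mechanism n d \<alpha> Z Q}. mechanism_risk r n d p0 \<delta> Z Q)"

text \<open>
  For \<open>r \<in> {1, 2}\<close> and \<open>d \<ge> 1\<close> the set below is nonempty: it contains every \<open>\<delta> > 2\<close>, for which
  there are no alternatives. It is bounded below by \<open>0\<close>, so the real infimum is the genuine one.
\<close>

definition testing_radius ::
  "nat \<Rightarrow> nat \<Rightarrow> nat \<Rightarrow> real \<Rightarrow> real \<Rightarrow> (nat \<Rightarrow> real) \<Rightarrow> real" where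
  "testing_radius r n d \<alpha> \<gamma> p0 = Inf {\<delta>. \<delta> > 0 \<and> private_risk r n d \<alpha> p0 \<delta> \<le> ennreal \<gamma>}"

definition tail_index :: "nat \<Rightarrow> nat \<Rightarrow> real \<Rightarrow> (nat \<Rightarrow> real) \<Rightarrow> nat" where
  "tail_index n d \<alpha> p0 =
    Min {j \<in> {1..d}. sqrt (real j) / sqrt (real n * \<alpha>\<^sup>2) \<ge> (\<Sum>j'=j+1..d. p0 j')}"

end

theory Submission
  imports Defs
begin

text \<open>Let the first user publish \<open>m\<close> random subsets \<open>A\<^sub>0, ..., A\<^sub>m\<^sub>-\<^sub>1\<close> of \<open>{1..d}\<close> (as he ignores his datum, this
  costs no privacy), and let the users of the \<open>b\<close>-th of \<open>m\<close> batches answer the question whether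
  \<open>X \<in> A\<^sub>b\<close> by randomised response with bias of order \<open>\<alpha>\<close>. Under \<open>p\<close> and \<open>p0\<close> the mean answers differ by a
  multiple of \<open>\<alpha>\<close> times the Rademacher sum \<open>\<Sum>j. \<plusminus> (p j - p0 j)\<close>, which by a second and fourth moment
  argument is at least half of the Euclidean distance with probability at least \<open>1/5\<close>. Hence all \<open>m\<close>
  batches miss the alternative with probability at most \<open>(4/5)^m\<close>, and by Chebyshev's inequality the
  sampling error of all batches is negligible once the distance is of order \<open>m / sqrt (n \<alpha>\<^sup>2 \<gamma>)\<close>.
  With \<open>m\<close> of order \<open>1 / sqrt \<gamma>\<close> this gives the rate \<open>1 / sqrt (n \<alpha>\<^sup>2 \<gamma>\<^sup>2)\<close> for the \<open>L2\<close> norm. The same test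
  serves the \<open>L1\<close> norm, because \<open>L1\<close> alternatives are \<open>L2\<close> alternatives by the Cauchy--Schwarz inequality
  on \<open>B\<close>.\<close>

subsection \<open>Moments of finite product weights\<close>

lemma sum_PiE_insert:
  assumes "a \<notin> I"
  shows "(\<Sum>z\<in>Pi\<^sub>E (insert a I) F. f z) = (\<Sum>y\<in>F a. \<Sum>z\<in>Pi\<^sub>E I F. f (z(a := y)))"
  unfolding PiE_insert_eq
  by (subst sum.reindex[OF inj_combinator[OF assms]])
    (simp add: sum.cartesian_product case_prod_unfold o_def)

text \<open>With \<open>b\<close> read as a product distribution, the coordinates are independent
  and every \<open>g i\<close> is centred, so cross terms vanish and variances add up; the induction
  splits off one coordinate.\<close>

lemma second_moment_sum_PiE:
  fixes b g :: "'i \<Rightarrow> 'a \<Rightarrow> real"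
  assumes "finite I" and "\<And>i. i \<in> I \<Longrightarrow> finite (F i)"
    and b: "\<And>i. i \<in> I \<Longrightarrow> (\<Sum>y\<in>F i. b i y) = 1"
    and g: "\<And>i. i \<in> I \<Longrightarrow> (\<Sum>y\<in>F i. b i y * g i y) = 0"
  shows "(\<Sum>z\<in>Pi\<^sub>E I F. (\<Prod>i\<in>I. b i (z i)) * (\<Sum>i\<in>I. g i (z i))\<^sup>2)
    = (\<Sum>i\<in>I. \<Sum>y\<in>F i. b i y * (g i y)\<^sup>2)"
  using assms
proof (induction I rule: finite_induct)
  case (insert a I)
  let ?b = "\<lambda>z. \<Prod>i\<in>I. b i (z i)" and ?g = "\<lambda>z. \<Sum>i\<in>I. g i (z i)"
  have fin: "finite (F a)" "\<And>i. i \<in> I \<Longrightarrow> finite (F i)" using insert by auto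
  have one: "(\<Sum>z\<in>Pi\<^sub>E I F. ?b z) = 1"
    using insert fin by (subst prod_sum_PiE[symmetric]) auto
  have upd: "(\<Prod>i\<in>insert a I. b i ((z(a := y)) i)) = b a y * ?b z"
    "(\<Sum>i\<in>insert a I. g i ((z(a := y)) i)) = g a y + ?g z" for z y
    using insert.hyps by (auto intro!: prod.cong sum.cong arg_cong2[where f = "(*)"] arg_cong2[where f = "(+)"])
  have "(\<Sum>z\<in>Pi\<^sub>E (insert a I) F. (\<Prod>i\<in>insert a I. b i (z i)) * (\<Sum>i\<in>insert a I. g i (z i))\<^sup>2)
      = (\<Sum>y\<in>F a. \<Sum>z\<in>Pi\<^sub>E I F. b a y * ?b z * (g a y + ?g z)\<^sup>2)"
    using insert.hyps by (subst sum_PiE_insert) (simp_all only: upd not_False_eq_True)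
  also have "\<dots> = (\<Sum>y\<in>F a. \<Sum>z\<in>Pi\<^sub>E I F. (b a y * (g a y)\<^sup>2) * ?b z
      + 2 * ((b a y * g a y) * (?b z * ?g z)) + b a y * (?b z * (?g z)\<^sup>2))"
    by (intro sum.cong) (auto simp: power2_eq_square algebra_simps)
  also have "\<dots> = (\<Sum>y\<in>F a. b a y * (g a y)\<^sup>2) * (\<Sum>z\<in>Pi\<^sub>E I F. ?b z)
      + 2 * ((\<Sum>y\<in>F a. b a y * g a y) * (\<Sum>z\<in>Pi\<^sub>E I F. ?b z * ?g z))
      + (\<Sum>y\<in>F a. b a y) * (\<Sum>z\<in>Pi\<^sub>E I F. ?b z * (?g z)\<^sup>2)"
    by (simp only: sum.distrib sum_product sum_distrib_left[where r = "2::real", symmetric])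
  also have "\<dots> = (\<Sum>y\<in>F a. b a y * (g a y)\<^sup>2) + (\<Sum>z\<in>Pi\<^sub>E I F. ?b z * (?g z)\<^sup>2)"
    using insert.prems by (simp add: one)
  also have "\<dots> = (\<Sum>i\<in>insert a I. \<Sum>y\<in>F i. b i y * (g i y)\<^sup>2)"
    using insert by simp
  finally show ?case .
qed simp

text \<open>A function on all reals that vanishes off 0 and 1, because the binary answers share one
  alphabet with the codes of the seeds.\<close>

definition bernoulli_weight :: "real \<Rightarrow> real \<Rightarrow> real" where
  "bernoulli_weight \<theta> y = (if y = 1 then \<theta> else if y = 0 then 1 - \<theta> else 0)"

lemma bernoulli_weight_nonneg: "\<theta> \<in> {0..1} \<Longrightarrow> 0 \<le> bernoulli_weight \<theta> y"
  by (auto simp: bernoulli_weight_def)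

lemma sum_bernoulli_weight:
  assumes "finite S" "0 \<in> S" "1 \<in> S"
  shows "(\<Sum>y\<in>S. bernoulli_weight \<theta> y * f y) = \<theta> * f 1 + (1 - \<theta>) * f 0"
proof -
  have "(\<Sum>y\<in>S. bernoulli_weight \<theta> y * f y) = (\<Sum>y\<in>{0, 1}. bernoulli_weight \<theta> y * f y)"
    using assms by (intro sum.mono_neutral_right) (auto simp: bernoulli_weight_def)
  then show ?thesis by (simp add: bernoulli_weight_def)
qed

text \<open>Chebyshev's inequality with variance at most 1/4 per coordinate. The weight lives on all
  of \<open>I\<close> while only \<open>J\<close> is summed, since a batch is a part of the
  users.\<close>

lemma bernoulli_chebyshev:
  assumes S: "finite S" "0 \<in> S" "1 \<in> S" and "finite I" "J \<subseteq> I"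
    and \<theta>: "\<And>i. i \<in> I \<Longrightarrow> \<theta> i \<in> {0..1}" and "0 < c"
  shows "(\<Sum>z\<in>I \<rightarrow>\<^sub>E S. (\<Prod>i\<in>I. bernoulli_weight (\<theta> i) (z i)) *
      of_bool (c \<le> \<bar>(\<Sum>i\<in>J. z i) - (\<Sum>i\<in>J. \<theta> i)\<bar>)) \<le> real (card J) / (4 * c\<^sup>2)"
proof -
  let ?b = "\<lambda>z. \<Prod>i\<in>I. bernoulli_weight (\<theta> i) (z i)"
  \<comment> \<open>Extension by 0 outside \<open>J\<close> turns the centred sum over
    \<open>J\<close> into one over \<open>I\<close>, the form of the second moment formula.\<close>
  define g where "g i y = (if i \<in> J then y - \<theta> i else 0)" for i y
  have gJ: "(\<Sum>i\<in>J. z i) - (\<Sum>i\<in>J. \<theta> i) = (\<Sum>i\<in>I. g i (z i))" for z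
    using assms by (auto simp: g_def sum_subtractf sum.If_cases Int_absorb1)
  have "(\<Sum>z\<in>I \<rightarrow>\<^sub>E S. ?b z * of_bool (c \<le> \<bar>(\<Sum>i\<in>J. z i) - (\<Sum>i\<in>J. \<theta> i)\<bar>))
      \<le> (\<Sum>z\<in>I \<rightarrow>\<^sub>E S. ?b z * ((\<Sum>i\<in>I. g i (z i))\<^sup>2 / c\<^sup>2))"
  proof (intro sum_mono mult_left_mono)
    show "of_bool (c \<le> \<bar>(\<Sum>i\<in>J. z i) - (\<Sum>i\<in>J. \<theta> i)\<bar>) \<le> (\<Sum>i\<in>I. g i (z i))\<^sup>2 / c\<^sup>2" for z
      using power_mono[of c "\<bar>\<Sum>i\<in>I. g i (z i)\<bar>" 2] \<open>0 < c\<close> unfolding gJ by (auto simp: field_simps)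
    show "0 \<le> ?b z" for z
      using \<theta> by (intro prod_nonneg) (auto intro: bernoulli_weight_nonneg)
  qed
  also have "\<dots> = (\<Sum>z\<in>I \<rightarrow>\<^sub>E S. ?b z * (\<Sum>i\<in>I. g i (z i))\<^sup>2) / c\<^sup>2"
    by (simp add: sum_divide_distrib)
  also have "(\<Sum>z\<in>I \<rightarrow>\<^sub>E S. ?b z * (\<Sum>i\<in>I. g i (z i))\<^sup>2)
      = (\<Sum>i\<in>I. \<Sum>y\<in>S. bernoulli_weight (\<theta> i) y * (g i y)\<^sup>2)"
  proof (rule second_moment_sum_PiE)
    show "(\<Sum>y\<in>S. bernoulli_weight (\<theta> i) y) = 1" for i
      using sum_bernoulli_weight[OF S, of "\<theta> i" "\<lambda>_. 1"] by simp
    show "(\<Sum>y\<in>S. bernoulli_weight (\<theta> i) y * g i y) = 0" for i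
      by (simp add: sum_bernoulli_weight[OF S] g_def algebra_simps)
  qed (use assms in auto)
  also have "\<dots> \<le> (\<Sum>i\<in>I. if i \<in> J then 1 / 4 else 0)"
  proof (rule sum_mono)
    fix i
    \<comment> \<open>The left side is the Bernoulli variance \<theta>(1 - \<theta>).\<close>
    have "\<theta> i * (1 - \<theta> i)\<^sup>2 + (1 - \<theta> i) * (\<theta> i)\<^sup>2 = 1 / 4 - (\<theta> i - 1 / 2)\<^sup>2"
      by (simp add: power2_eq_square algebra_simps)
    then show "(\<Sum>y\<in>S. bernoulli_weight (\<theta> i) y * (g i y)\<^sup>2) \<le> (if i \<in> J then 1 / 4 else 0)"
      by (simp add: sum_bernoulli_weight[OF S] g_def)
  qed
  also have "\<dots> = real (card J) / 4"
    using assms by (simp add: sum.If_cases Int_absorb1)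
  finally show ?thesis
    using \<open>0 < c\<close> by (simp add: divide_right_mono)
qed

subsection \<open>Rademacher sums\<close>

text \<open>Signs are encoded by the set of indices with sign +1, so uniform signs are a uniform
  subset, which doubles as the question put to a batch.\<close>

definition signed_sum :: "'a set \<Rightarrow> ('a \<Rightarrow> real) \<Rightarrow> 'a set \<Rightarrow> real" where
  "signed_sum D v A = (\<Sum>j\<in>D. if j \<in> A then v j else - v j)"

lemma sum_Pow_insert:
  assumes "finite D" "a \<notin> D"
  shows "(\<Sum>A\<in>Pow (insert a D). f A) = (\<Sum>A\<in>Pow D. f A + f (insert a A))"
proof -
  have "inj_on (insert a) (Pow D)"
    using assms by (auto simp: inj_on_def)
  moreover have "Pow D \<inter> insert a ` Pow D = {}"
    using assms by auto
  ultimately show ?thesis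
    using assms by (simp add: Pow_insert sum.union_disjoint sum.reindex sum.distrib)
qed

text \<open>A new index \<open>a\<close> turns each value Y into the pair Y - v a, Y + v a; adding
  their even powers cancels all odd terms.\<close>

lemma signed_sum_moments:
  assumes "finite D"
  shows "(\<Sum>A\<in>Pow D. (signed_sum D v A)\<^sup>2) = 2 ^ card D * (\<Sum>j\<in>D. (v j)\<^sup>2) \<and>
    (\<Sum>A\<in>Pow D. (signed_sum D v A) ^ 4) \<le> 3 * 2 ^ card D * (\<Sum>j\<in>D. (v j)\<^sup>2)\<^sup>2"
  using assms
proof (induction D rule: finite_induct)
  case empty
  then show ?case by (simp add: signed_sum_def)
next
  case (insert a D)
  let ?Y = "signed_sum D v" and ?V = "\<Sum>j\<in>D. (v j)\<^sup>2"
  have Y: "signed_sum (insert a D) v A = ?Y A - v a"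
    "signed_sum (insert a D) v (insert a A) = ?Y A + v a" if "A \<in> Pow D" for A
    using insert.hyps that by (auto simp: signed_sum_def intro!: sum.cong)
  have "(\<Sum>A\<in>Pow (insert a D). (signed_sum (insert a D) v A)\<^sup>2)
      = (\<Sum>A\<in>Pow D. 2 * (?Y A)\<^sup>2 + 2 * (v a)\<^sup>2)"
    using insert.hyps by (subst sum_Pow_insert)
      (auto simp: Y power2_eq_square algebra_simps intro!: sum.cong)
  also have "\<dots> = 2 ^ card (insert a D) * (\<Sum>j\<in>insert a D. (v j)\<^sup>2)"
    using insert by (simp add: sum.distrib card_Pow algebra_simps flip: sum_distrib_left)
  finally have m2: "(\<Sum>A\<in>Pow (insert a D). (signed_sum (insert a D) v A)\<^sup>2)
    = 2 ^ card (insert a D) * (\<Sum>j\<in>insert a D. (v j)\<^sup>2)" .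
  have "(\<Sum>A\<in>Pow (insert a D). (signed_sum (insert a D) v A) ^ 4)
      = (\<Sum>A\<in>Pow D. 2 * (?Y A) ^ 4 + 12 * (v a)\<^sup>2 * (?Y A)\<^sup>2 + 2 * (v a) ^ 4)"
    using insert.hyps by (subst sum_Pow_insert)
      (auto simp: Y power2_eq_square power4_eq_xxxx algebra_simps intro!: sum.cong)
  also have "\<dots> = 2 * (\<Sum>A\<in>Pow D. (?Y A) ^ 4) + 12 * (v a)\<^sup>2 * (\<Sum>A\<in>Pow D. (?Y A)\<^sup>2)
      + 2 * 2 ^ card D * (v a) ^ 4"
    using insert by (simp add: sum.distrib card_Pow algebra_simps flip: sum_distrib_left)
  \<comment> \<open>Raising the last coefficient from 2 to 6 completes the square of
    \<open>?V\<close> plus the square of \<open>v a\<close>.\<close>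
  also have "\<dots> \<le> 2 * (3 * 2 ^ card D * ?V\<^sup>2) + 12 * (v a)\<^sup>2 * (2 ^ card D * ?V)
      + 6 * 2 ^ card D * (v a) ^ 4"
    using insert.IH by (intro add_mono mult_left_mono mult_right_mono) auto
  also have "\<dots> = 3 * 2 ^ card (insert a D) * (\<Sum>j\<in>insert a D. (v j)\<^sup>2)\<^sup>2"
    using insert.hyps by (simp add: power2_eq_square power4_eq_xxxx algebra_simps)
  finally show ?case using m2 by simp
qed

text \<open>The parabola \<open>(x - V/4) (7V - x)\<close>, scaled to have maximum \<open>1\<close>, minorises the indicator of
  \<open>x \<ge> V/4\<close>; its mean at \<open>x = signed_sum\<^sup>2\<close> only involves the second and fourth moments.\<close>

lemma card_small_signed_sum:
  assumes "finite D" and V: "V = (\<Sum>j\<in>D. (v j)\<^sup>2)" "0 < V"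
  shows "real (card {A \<in> Pow D. (signed_sum D v A)\<^sup>2 < V / 4}) \<le> 4 / 5 * 2 ^ card D"
proof -
  let ?x = "\<lambda>A. (signed_sum D v A)\<^sup>2"
  let ?B = "{A \<in> Pow D. ?x A < V / 4}"
  \<comment> \<open>The maximum is at 29V/8, midway between the zeros, and equals (27V/8)^2 = 729
    V^2 / 64.\<close>
  have par: "64 * ((x - V / 4) * (7 * V - x)) \<le> 729 * V\<^sup>2 * (1 - of_bool (x < V / 4))"
    if "0 \<le> x" for x
  proof (cases "x < V / 4")
    case True
    then have "(x - V / 4) * (7 * V - x) \<le> 0"
      using V(2) by (intro mult_nonpos_nonneg) auto
    with True show ?thesis by simp
  next
    case False
    have "0 \<le> (8 * x - 29 * V)\<^sup>2" by simp
    then have "64 * ((x - V / 4) * (7 * V - x)) \<le> 729 * V\<^sup>2"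
      by (simp add: power2_eq_square algebra_simps)
    with False show ?thesis by simp
  qed
  \<comment> \<open>The moments give the parabola a mean of at least (29/4 - 3 - 7/4) V^2 = 5/2
    V^2.\<close>
  have "64 * (5 / 2 * V\<^sup>2 * 2 ^ card D)
      \<le> 64 * (29 / 4 * V * (2 ^ card D * V) - 3 * 2 ^ card D * V\<^sup>2 - 7 / 4 * V\<^sup>2 * 2 ^ card D)"
    by (simp add: power2_eq_square algebra_simps)
  also have "\<dots> \<le> 64 * (29 / 4 * V * (\<Sum>A\<in>Pow D. ?x A) - (\<Sum>A\<in>Pow D. (signed_sum D v A) ^ 4)
      - 7 / 4 * V\<^sup>2 * 2 ^ card D)"
    using signed_sum_moments[OF assms(1), of v] V by simp
  also have "\<dots> = 64 * (\<Sum>A\<in>Pow D. 29 / 4 * V * ?x A - (signed_sum D v A) ^ 4 - 7 / 4 * V\<^sup>2)"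
    using assms(1) by (simp add: sum_subtractf card_Pow sum_distrib_left)
  also have "\<dots> = (\<Sum>A\<in>Pow D. 64 * ((?x A - V / 4) * (7 * V - ?x A)))"
    unfolding sum_distrib_left
    by (intro sum.cong) (auto simp: power2_eq_square power4_eq_xxxx algebra_simps)
  also have "\<dots> \<le> (\<Sum>A\<in>Pow D. 729 * V\<^sup>2 * (1 - of_bool (?x A < V / 4)))"
    by (intro sum_mono par) simp
  also have "\<dots> = 729 * V\<^sup>2 * (2 ^ card D - real (card ?B))"
    unfolding sum_distrib_left[symmetric] sum_subtractf
    using assms(1) by (simp add: card_Pow Int_def)
  \<comment> \<open>At least a fraction 160/729 of the subsets is good, which exceeds 1/5.\<close>
  finally have "V\<^sup>2 * (160 * 2 ^ card D) \<le> V\<^sup>2 * (729 * (2 ^ card D - real (card ?B)))"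
    by (simp add: algebra_simps)
  then have "160 * 2 ^ card D \<le> 729 * (2 ^ card D - real (card ?B))"
    using V(2) by (simp add: mult_le_cancel_left_pos del: mult_le_cancel_left)
  then show ?thesis by simp
qed

subsection \<open>Private laws on finite alphabets\<close>

lemma prob_space_point_measure_real:
  assumes "finite A" "\<And>a. a \<in> A \<Longrightarrow> 0 \<le> w a" "(\<Sum>a\<in>A. w a) = (1::real)"
  shows "prob_space (point_measure A (\<lambda>a. ennreal (w a)))"
  using assms by (intro prob_space_point_measure) (auto simp: sum_ennreal)

lemma point_measure_eqI:
  assumes "finite A" "sets M = Pow A" "\<And>a. a \<in> A \<Longrightarrow> emeasure M {a} = f a"
  shows "M = point_measure A f"
  using assms by (intro measure_eqI_finite[of _ A])
    (auto simp: sets_point_measure emeasure_point_measure_finite)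

lemma point_measure_cong:
  assumes "\<And>a. a \<in> A \<Longrightarrow> f a = g a"
  shows "point_measure A f = point_measure A g"
  unfolding point_measure_def using assms by (intro density_cong) (auto simp: AE_count_space)

text \<open>The law of total probability. On a finite set with all subsets measurable it suffices to
  compare singletons.\<close>

lemma bind_point_measure:
  fixes w :: "'a \<Rightarrow> real" and g :: "'a \<Rightarrow> 'b \<Rightarrow> real"
  assumes "finite A" "A \<noteq> {}" "finite B"
    and w: "\<And>a. a \<in> A \<Longrightarrow> 0 \<le> w a"
    and g: "\<And>a b. a \<in> A \<Longrightarrow> b \<in> B \<Longrightarrow> 0 \<le> g a b" "\<And>a. a \<in> A \<Longrightarrow> (\<Sum>b\<in>B. g a b) = 1"
    and f: "\<And>a. a \<in> A \<Longrightarrow> f a = point_measure B (\<lambda>b. ennreal (g a b))"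
  shows "point_measure A (\<lambda>a. ennreal (w a)) \<bind> f
    = point_measure B (\<lambda>b. ennreal (\<Sum>a\<in>A. w a * g a b))"
proof (rule point_measure_eqI)
  have meas: "f \<in> point_measure A (\<lambda>a. ennreal (w a)) \<rightarrow>\<^sub>M subprob_algebra (count_space B)"
    using assms by (auto simp: space_subprob_algebra sets_point_measure
        intro!: prob_space_imp_subprob_space prob_space_point_measure_real)
  show "sets (point_measure A (\<lambda>a. ennreal (w a)) \<bind> f) = Pow B"
    using assms sets_bind[of "point_measure A (\<lambda>a. ennreal (w a))" f "count_space B"]
    by (simp add: space_point_measure sets_point_measure)
  show "emeasure (point_measure A (\<lambda>a. ennreal (w a)) \<bind> f) {b} = ennreal (\<Sum>a\<in>A. w a * g a b)"
    if "b \<in> B" for b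
    using assms that by (subst emeasure_bind[OF _ meas])
      (auto simp: space_point_measure nn_integral_point_measure_finite emeasure_point_measure_finite
        ennreal_mult'' mult_ac simp flip: sum_ennreal intro!: sum.cong)
qed (fact assms)

lemma sets_PiM_finite:
  assumes "finite I" "finite S" "\<And>i. i \<in> I \<Longrightarrow> sets (M i) = Pow S"
  shows "sets (Pi\<^sub>M I M) = Pow (I \<rightarrow>\<^sub>E S)"
proof -
  have "sets (Pi\<^sub>M I M) = sets (Pi\<^sub>M I (\<lambda>_. count_space S))"
    using assms by (intro sets_PiM_cong) auto
  then show ?thesis
    using assms by (simp add: count_space_PiM_finite countable_finite)
qed

lemma PiM_point_measure:
  fixes p :: "'a \<Rightarrow> real"
  assumes "finite I" "finite S" and p: "\<And>a. a \<in> S \<Longrightarrow> 0 \<le> p a"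
  shows "Pi\<^sub>M I (\<lambda>_. point_measure S (\<lambda>a. ennreal (p a)))
    = point_measure (I \<rightarrow>\<^sub>E S) (\<lambda>x. ennreal (\<Prod>i\<in>I. p (x i)))"
proof (rule point_measure_eqI)
  let ?M = "point_measure S (\<lambda>a. ennreal (p a))"
  have "finite_measure ?M"
    using assms by (intro finite_measureI) (auto simp: emeasure_point_measure_finite space_point_measure)
  then interpret product_sigma_finite "\<lambda>_. ?M"
    unfolding product_sigma_finite_def by (simp add: finite_measure.axioms)
  show "sets (Pi\<^sub>M I (\<lambda>_. ?M)) = Pow (I \<rightarrow>\<^sub>E S)"
    using assms by (intro sets_PiM_finite) (auto simp: sets_point_measure)
  show "emeasure (Pi\<^sub>M I (\<lambda>_. ?M)) {x} = ennreal (\<Prod>i\<in>I. p (x i))" if "x \<in> I \<rightarrow>\<^sub>E S" for x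
  proof -
    have "{x} = Pi\<^sub>E I (\<lambda>i. {x i})"
      using that by (auto simp: PiE_singleton PiE_iff)
    then have "emeasure (Pi\<^sub>M I (\<lambda>_. ?M)) {x} = (\<Prod>i\<in>I. emeasure ?M {x i})"
      using assms that by (simp add: emeasure_PiM sets_point_measure PiE_iff)
    also have "\<dots> = ennreal (\<Prod>i\<in>I. p (x i))"
      using assms that
      by (auto simp: emeasure_point_measure_finite PiE_iff prod_ennreal intro!: prod.cong)
    finally show ?thesis .
  qed
qed (use assms in \<open>auto intro: finite_PiE\<close>)

section \<open>Sequential mechanisms given by finite weights\<close>

definition kernel_weight ::
  "(nat \<Rightarrow> nat \<Rightarrow> (nat \<Rightarrow> 'z) \<Rightarrow> 'z \<Rightarrow> real) \<Rightarrow> 'z set \<Rightarrow> nat set \<Rightarrow> nat \<Rightarrow> bool"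
where
  "kernel_weight q S X n \<longleftrightarrow> (\<forall>i\<in>{1..n}. \<forall>x\<in>X. \<forall>z\<in>{1..<i} \<rightarrow>\<^sub>E S.
     (\<forall>y\<in>S. 0 \<le> q i x z y) \<and> (\<Sum>y\<in>S. q i x z y) = 1)"

text \<open>The chain rule: each new private datum multiplies the weight by its conditional
  probability given the history, which for user \<open>i\<close> is \<open>z\<close> restricted to
  \<open>{1..<i}\<close>.\<close>

lemma private_law_given_point_measure:
  fixes q :: "nat \<Rightarrow> nat \<Rightarrow> (nat \<Rightarrow> 'z) \<Rightarrow> 'z \<Rightarrow> real"
  assumes S: "finite S" "S \<noteq> {}" and q: "kernel_weight q S X n"
    and x: "\<And>i. i \<in> {1..n} \<Longrightarrow> x i \<in> X" and "k \<le> n"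
  shows "private_law_given (count_space S) (\<lambda>i x z. point_measure S (\<lambda>y. ennreal (q i x z y))) x k
    = point_measure ({1..k} \<rightarrow>\<^sub>E S)
        (\<lambda>z. ennreal (\<Prod>i\<in>{1..k}. q i (x i) (restrict z {1..<i}) (z i)))"
  using \<open>k \<le> n\<close>
proof (induction k)
  case 0
  show ?case
    by (auto intro!: point_measure_eqI simp: sets_PiM_finite PiM_empty)
next
  case (Suc k)
  let ?Q = "\<lambda>z. q (Suc k) (x (Suc k)) z"
  let ?W = "\<lambda>k z. \<Prod>i\<in>{1..k}. q i (x i) (restrict z {1..<i}) (z i)"
  \<comment> \<open>The transition from a history \<open>z\<close> to a longer history
    \<open>z'\<close>; it vanishes unless \<open>z'\<close> extends \<open>z\<close>.\<close>
  let ?g = "\<lambda>z z'. if restrict z' {1..k} = z then ?Q z (z' (Suc k)) else 0"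
  let ?P = "\<lambda>k. {1..k} \<rightarrow>\<^sub>E S"
  have PSuc: "?P (Suc k) = insert (Suc k) {1..k} \<rightarrow>\<^sub>E S"
    by (simp add: atLeastAtMostSuc_conv)
  have Q: "0 \<le> ?Q z y" "(\<Sum>y\<in>S. ?Q z y) = 1" if "z \<in> ?P k" "y \<in> S" for z y
    using that q Suc.prems x[of "Suc k"]
    by (auto simp: kernel_weight_def atLeastLessThanSuc_atLeastAtMost)
  have restr: "restrict z' {1..k} \<in> ?P k" if "z' \<in> ?P (Suc k)" for z'
    using that by auto
  have W: "0 \<le> ?W k z" if "z \<in> ?P k" for z
  proof (rule prod_nonneg)
    fix i assume "i \<in> {1..k}"
    then show "0 \<le> q i (x i) (restrict z {1..<i}) (z i)"
      using that q Suc.prems x[of i] unfolding kernel_weight_def by (auto simp: PiE_iff)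
  qed
  have ker: "distr (point_measure S (\<lambda>y. ennreal (?Q z y))) (Pi\<^sub>M {1..Suc k} (\<lambda>_. count_space S))
      (\<lambda>y. z(Suc k := y)) = point_measure (?P (Suc k)) (\<lambda>z'. ennreal (?g z z'))"
    if z: "z \<in> ?P k" for z
  proof (rule point_measure_eqI)
    show "finite (?P (Suc k))" using S by (auto intro: finite_PiE)
    show sets: "sets (distr (point_measure S (\<lambda>y. ennreal (?Q z y)))
      (Pi\<^sub>M {1..Suc k} (\<lambda>_. count_space S)) (\<lambda>y. z(Suc k := y))) = Pow (?P (Suc k))"
      using S by (simp add: sets_PiM_finite)
    fix z' assume z': "z' \<in> ?P (Suc k)"
    have "space (Pi\<^sub>M {1..Suc k} (\<lambda>_. count_space S)) = ?P (Suc k)"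
      by (simp add: space_PiM)
    moreover have up: "z(Suc k := y) \<in> ?P (Suc k)" if "y \<in> S" for y
      using z that unfolding PSuc by (intro PiE_fun_upd) auto
    ultimately have m: "(\<lambda>y. z(Suc k := y)) \<in> point_measure S (\<lambda>y. ennreal (?Q z y))
        \<rightarrow>\<^sub>M Pi\<^sub>M {1..Suc k} (\<lambda>_. count_space S)"
      by auto
    \<comment> \<open>An extension of \<open>z\<close> is determined by its last entry, so the
      preimage of \<open>{z'}\<close> has at most one element.\<close>
    have eq: "z(Suc k := y) = z' \<longleftrightarrow> restrict z' {1..k} = z \<and> y = z' (Suc k)" if "y \<in> S" for y
    proof
      assume h: "z(Suc k := y) = z'"
      have "restrict (z(Suc k := y)) {1..k} = z"
        using z by (auto simp: fun_eq_iff PiE_iff extensional_def)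
      then show "restrict z' {1..k} = z \<and> y = z' (Suc k)"
        unfolding h using fun_cong[OF h, of "Suc k"] by simp
    next
      assume h: "restrict z' {1..k} = z \<and> y = z' (Suc k)"
      have "(restrict z' {1..k})(Suc k := z' (Suc k)) = z'"
        using z' by (auto simp: fun_eq_iff PiE_iff extensional_def)
      then show "z(Suc k := y) = z'" using h by metis
    qed
    have "(\<lambda>y. z(Suc k := y)) -` {z'} \<inter> S = {y \<in> S. z(Suc k := y) = z'}"
      by auto
    also have "\<dots> = {y \<in> S. restrict z' {1..k} = z \<and> y = z' (Suc k)}"
      by (rule Collect_cong) (use eq in blast)
    also have "\<dots> = (if restrict z' {1..k} = z then {z' (Suc k)} else {})"
    proof -
      have "z' (Suc k) \<in> S" using z' by (simp add: PiE_iff)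
      then have "{y \<in> S. b \<and> y = z' (Suc k)} = (if b then {z' (Suc k)} else {})" for b
        by auto
      then show ?thesis .
    qed
    finally show "emeasure (distr (point_measure S (\<lambda>y. ennreal (?Q z y)))
      (Pi\<^sub>M {1..Suc k} (\<lambda>_. count_space S)) (\<lambda>y. z(Suc k := y))) {z'} = ennreal (?g z z')"
      using m S z' by (subst emeasure_distr[OF m])
        (auto simp: sets_PiM_finite space_point_measure emeasure_point_measure_finite PiE_iff)
  qed
  have "private_law_given (count_space S) (\<lambda>i x z. point_measure S (\<lambda>y. ennreal (q i x z y))) x (Suc k)
    = point_measure (?P (Suc k)) (\<lambda>z'. ennreal (\<Sum>z\<in>?P k. ?W k z * ?g z z'))"
    unfolding private_law_given.simps Suc.IH[OF Suc_leD[OF Suc.prems]]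
  proof (rule bind_point_measure)
    show "?P k \<noteq> {}" using S by (simp add: PiE_eq_empty_iff)
    show "0 \<le> ?g z z'" if "z \<in> ?P k" "z' \<in> ?P (Suc k)" for z z'
      using Q that by (auto simp: PiE_iff)
    show "(\<Sum>z'\<in>?P (Suc k). ?g z z') = 1" if z: "z \<in> ?P k" for z
    proof -
      have "restrict (z'(Suc k := y)) {1..k} = z'" if "z' \<in> ?P k" for z' y
        using that by (auto simp: fun_eq_iff PiE_iff extensional_def)
      then have "(\<Sum>z'\<in>?P (Suc k). ?g z z') = (\<Sum>y\<in>S. \<Sum>z'\<in>?P k. if z' = z then ?Q z y else 0)"
        unfolding PSuc by (subst sum_PiE_insert) (auto intro!: sum.cong)
      also have "\<dots> = 1"
        using S z Q by (auto simp: finite_PiE sum.delta)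
      finally show ?thesis .
    qed
  qed (use S W ker in \<open>auto intro: finite_PiE\<close>)
  also have "\<dots> = point_measure (?P (Suc k)) (\<lambda>z'. ennreal (?W (Suc k) z'))"
  proof (rule point_measure_cong)
    show "ennreal (\<Sum>z\<in>?P k. ?W k z * ?g z z') = ennreal (?W (Suc k) z')"
      if z': "z' \<in> ?P (Suc k)" for z'
    proof -
      have "(\<Sum>z\<in>?P k. ?W k z * ?g z z')
          = (\<Sum>z\<in>?P k. if z = restrict z' {1..k} then ?W k z * ?Q z (z' (Suc k)) else 0)"
        by (intro sum.cong) auto
      also have "\<dots> = ?W k (restrict z' {1..k}) * ?Q (restrict z' {1..k}) (z' (Suc k))"
        using S restr[OF z'] by (simp add: finite_PiE)
      \<comment> \<open>For i <= k, the history and the entry of user \<open>i\<close> both lie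
        within \<open>{1..k}\<close>.\<close>
      also have "?W k (restrict z' {1..k}) = ?W k z'"
      proof (rule prod.cong)
        fix i assume "i \<in> {1..k}"
        then have "{1..k} \<inter> {1..<i} = {1..<i}" by auto
        with \<open>i \<in> {1..k}\<close> show "q i (x i) (restrict (restrict z' {1..k}) {1..<i}) (restrict z' {1..k} i)
            = q i (x i) (restrict z' {1..<i}) (z' i)"
          by (simp add: restrict_restrict)
      qed simp
      also have "?W k z' * ?Q (restrict z' {1..k}) (z' (Suc k)) = ?W (Suc k) z'"
        by (simp add: atLeastLessThanSuc_atLeastAtMost)
      finally show ?thesis by (rule arg_cong)
    qed
  qed
  finally show ?case .
qed

text \<open>Summing out the newest private datum first leaves the earlier factors untouched, because
  they only look at earlier entries. This makes the law given the raw data a stochastic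
  kernel.\<close>

lemma sum_kernel_weight:
  fixes q :: "nat \<Rightarrow> nat \<Rightarrow> (nat \<Rightarrow> 'z) \<Rightarrow> 'z \<Rightarrow> real"
  assumes q: "kernel_weight q S X n" and x: "\<And>i. i \<in> {1..n} \<Longrightarrow> x i \<in> X" and "k \<le> n"
  shows "(\<Sum>z\<in>{1..k} \<rightarrow>\<^sub>E S. \<Prod>i\<in>{1..k}. q i (x i) (restrict z {1..<i}) (z i)) = 1"
  using \<open>k \<le> n\<close>
proof (induction k)
  case (Suc k)
  let ?W = "\<lambda>k z. \<Prod>i\<in>{1..k}. q i (x i) (restrict z {1..<i}) (z i)"
  have step: "?W (Suc k) (z(Suc k := y)) = ?W k z * q (Suc k) (x (Suc k)) z y"
    if "z \<in> {1..k} \<rightarrow>\<^sub>E S" for z y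
  proof -
    have "restrict (z(Suc k := y)) {1..k} = z"
      using that by (auto simp: fun_eq_iff PiE_iff extensional_def)
    moreover have "?W k (z(Suc k := y)) = ?W k z"
    proof (rule prod.cong)
      fix i assume "i \<in> {1..k}"
      then have "restrict (z(Suc k := y)) {1..<i} = restrict z {1..<i}"
        by (auto simp: fun_eq_iff)
      then show "q i (x i) (restrict (z(Suc k := y)) {1..<i}) ((z(Suc k := y)) i)
          = q i (x i) (restrict z {1..<i}) (z i)"
        using \<open>i \<in> {1..k}\<close> by simp
    qed simp
    ultimately show ?thesis
      by (simp add: atLeastLessThanSuc_atLeastAtMost)
  qed
  have "{1..Suc k} = insert (Suc k) {1..k}" by auto
  then have "(\<Sum>z\<in>{1..Suc k} \<rightarrow>\<^sub>E S. ?W (Suc k) z)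
      = (\<Sum>y\<in>S. \<Sum>z\<in>{1..k} \<rightarrow>\<^sub>E S. ?W (Suc k) (z(Suc k := y)))"
    by (simp only:) (rule sum_PiE_insert, simp)
  also have "\<dots> = (\<Sum>z\<in>{1..k} \<rightarrow>\<^sub>E S. \<Sum>y\<in>S. ?W k z * q (Suc k) (x (Suc k)) z y)"
    using step by (subst sum.swap) (auto intro!: sum.cong)
  also have "\<dots> = (\<Sum>z\<in>{1..k} \<rightarrow>\<^sub>E S. ?W k z)"
  proof (rule sum.cong)
    fix z assume "z \<in> {1..k} \<rightarrow>\<^sub>E S"
    then have "(\<Sum>y\<in>S. q (Suc k) (x (Suc k)) z y) = 1"
      using q x[of "Suc k"] Suc.prems
      by (auto simp: kernel_weight_def atLeastLessThanSuc_atLeastAtMost)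
    then show "(\<Sum>y\<in>S. ?W k z * q (Suc k) (x (Suc k)) z y) = ?W k z"
      by (simp flip: sum_distrib_left)
  qed simp
  also have "\<dots> = 1"
    using Suc by (intro Suc.IH) simp
  finally show ?case .
qed simp

text \<open>Given the history, user \<open>i\<close> reacts to the own datum only, so averaging over
  the independent data can be done factor by factor. Expectations of tests become finite
  sums.\<close>

lemma integral_private_law:
  fixes q :: "nat \<Rightarrow> nat \<Rightarrow> (nat \<Rightarrow> 'z) \<Rightarrow> 'z \<Rightarrow> real"
  assumes S: "finite S" "S \<noteq> {}" and q: "kernel_weight q S {1..d} n" and p: "p \<in> prob_vectors d"
  shows "(\<integral>z. \<phi> z \<partial>private_law n d (count_space S)
      (\<lambda>i x z. point_measure S (\<lambda>y. ennreal (q i x z y))) p)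
    = (\<Sum>z\<in>{1..n} \<rightarrow>\<^sub>E S. (\<Prod>i\<in>{1..n}. \<Sum>j=1..d. p j * q i j (restrict z {1..<i}) (z i)) * \<phi> z)"
proof -
  let ?X = "{1..n} \<rightarrow>\<^sub>E {1..d}" and ?P = "{1..n} \<rightarrow>\<^sub>E S"
  let ?Q = "\<lambda>i x z. point_measure S (\<lambda>y. ennreal (q i x z y))"
  let ?W = "\<lambda>x z. \<Prod>i\<in>{1..n}. q i (x i) (restrict z {1..<i}) (z i)"
  let ?w = "\<lambda>z. \<Prod>i\<in>{1..n}. \<Sum>j=1..d. p j * q i j (restrict z {1..<i}) (z i)"
  have p0: "0 \<le> p j" if "j \<in> {1..d}" for j
    using p that by (auto simp: prob_vectors_def PiE_iff)
  have d: "d \<ge> 1"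
    using p by (cases "d = 0") (auto simp: prob_vectors_def)
  have q0: "0 \<le> q i j (restrict z {1..<i}) (z i)" if "z \<in> ?P" "i \<in> {1..n}" "j \<in> {1..d}" for z i j
  proof -
    have "restrict z {1..<i} \<in> {1..<i} \<rightarrow>\<^sub>E S" "z i \<in> S"
      using that by (auto simp: PiE_iff)
    then show ?thesis
      using q that unfolding kernel_weight_def by blast
  qed
  have "private_law n d (count_space S) ?Q p
      = point_measure ?X (\<lambda>x. ennreal (\<Prod>i\<in>{1..n}. p (x i))) \<bind>
          (\<lambda>x. private_law_given (count_space S) ?Q x n)"
    unfolding private_law_def data_law_def using p0 by (subst PiM_point_measure) auto
  also have "\<dots> = point_measure ?P (\<lambda>z. ennreal (\<Sum>x\<in>?X. (\<Prod>i\<in>{1..n}. p (x i)) * ?W x z))"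
  proof (rule bind_point_measure)
    show "finite ?X" "finite ?P" using S by (auto intro: finite_PiE)
    show "?X \<noteq> {}" using d by (simp add: PiE_eq_empty_iff)
    show "0 \<le> (\<Prod>i\<in>{1..n}. p (x i))" if "x \<in> ?X" for x
      using that p0 by (intro prod_nonneg) (auto simp: PiE_iff)
    show "0 \<le> ?W x z" if "x \<in> ?X" "z \<in> ?P" for x z
      using that q0 by (intro prod_nonneg) (auto simp: PiE_iff)
    show "(\<Sum>z\<in>?P. ?W x z) = 1" if "x \<in> ?X" for x
      using that by (intro sum_kernel_weight[OF q]) (auto simp: PiE_iff)
    show "private_law_given (count_space S) ?Q x n = point_measure ?P (\<lambda>z. ennreal (?W x z))"
      if "x \<in> ?X" for x
      using that S by (intro private_law_given_point_measure[OF _ _ q]) (auto simp: PiE_iff)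
  qed
  \<comment> \<open>Distributivity: the sum over all data vectors of a product is the product of the
    sums.\<close>
  also have "\<dots> = point_measure ?P (\<lambda>z. ennreal (?w z))"
    by (subst prod_sum_PiE) (simp_all add: prod.distrib)
  finally have law: "private_law n d (count_space S) ?Q p = point_measure ?P (\<lambda>z. ennreal (?w z))" .
  have "0 \<le> ?w z" if "z \<in> ?P" for z
    using that q0 p0 by (intro prod_nonneg sum_nonneg mult_nonneg_nonneg ballI) auto
  then show ?thesis
    unfolding law using S
    by (subst lebesgue_integral_point_measure_finite) (simp_all add: finite_PiE)
qed

subsection \<open>The public coin mechanism\<close>

lemma borel_measurable_PiM_finite:
  assumes "finite S"
  shows "f \<in> borel_measurable (Pi\<^sub>M {1..n::nat} (\<lambda>_. count_space S))"
  using assms by (simp add: count_space_PiM_finite countable_finite)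

text \<open>The first user ignores the datum and publishes a uniform element of \<open>S\<close>, which \<open>seed\<close> decodes as
  \<open>m\<close> independent uniform subsets of \<open>{1..d}\<close>. Users \<open>2, 3, ...\<close> form consecutive batches of equal
  size, numbered from \<open>0\<close>; users left over behind batch \<open>m - 1\<close> also answer, but are ignored.\<close>

locale public_coin =
  fixes n d m :: nat and t :: real and S :: "real set" and seed :: "real \<Rightarrow> nat \<Rightarrow> nat set"
  assumes S: "finite S" "0 \<in> S" "1 \<in> S"
    and seed: "bij_betw seed S ({..<m} \<rightarrow>\<^sub>E Pow {1..d})"
    and t: "0 < t" "t < 1" and n: "1 \<le> n"
begin

definition "batch_size = (n - 1) div m"

definition "batch b = {2 + b * batch_size ..< 2 + (b + 1) * batch_size}"

text \<open>The probability of the answer 1 in randomised response, 1/2 shifted by t/2 towards the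
  truth.\<close>

definition response :: "nat set \<Rightarrow> nat \<Rightarrow> real" where
  "response A x = (if x \<in> A then (1 + t) / 2 else (1 - t) / 2)"

text \<open>Behind the last batch the quotient leaves \<open>{..<m}\<close>, where
  \<open>seed\<close> yields an \<open>undefined\<close> set, and for \<open>batch_size = 0\<close>
  the quotient is 0. Randomised response to any set is private, so the mechanism is valid in these
  cases too.\<close>

definition weight :: "nat \<Rightarrow> nat \<Rightarrow> (nat \<Rightarrow> real) \<Rightarrow> real \<Rightarrow> real" where
  "weight i x z y = (if i = 1 then 1 / real (card S)
  else bernoulli_weight (response (seed (z 1) ((i - 2) div batch_size)) x) y)"

definition "mechanism i x z = point_measure S (\<lambda>y. ennreal (weight i x z y))"

text \<open>The Bernoulli parameter of an answer about \<open>A\<close> once the raw datum is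
  averaged out.\<close>

definition "mean p A = (\<Sum>j=1..d. p j * response A j)"

definition coin_test :: "(nat \<Rightarrow> real) \<Rightarrow> real \<Rightarrow> (nat \<Rightarrow> real) \<Rightarrow> real" where
  "coin_test p0 \<tau> z = of_bool (\<exists>b<m. real batch_size * \<tau>
     \<le> \<bar>(\<Sum>i\<in>batch b. z i) - real batch_size * mean p0 (seed (z 1) b)\<bar>)"

section \<open>Privacy of the coin mechanism\<close>

lemma card_S: "card S = 2 ^ (d * m)" "card S > 0"
proof -
  have "card S = card ({..<m} \<rightarrow>\<^sub>E Pow {1..d})"
    using seed by (rule bij_betw_same_card)
  then show "card S = 2 ^ (d * m)"
    by (simp add: card_PiE card_Pow power_mult)
  then show "card S > 0" by simp
qed

lemma response: "response A x \<in> {0..1}" "(1 - t) / 2 \<le> response A x" "response A x \<le> (1 + t) / 2"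
  using t by (auto simp: response_def)

lemma weight_nonneg: "0 \<le> weight i x z y"
  using bernoulli_weight_nonneg[OF response(1)] by (simp add: weight_def)

lemma sum_weight: "(\<Sum>y\<in>S. weight i x z y) = 1"
  using card_S(2) sum_bernoulli_weight[OF S, of _ "\<lambda>_. 1"]
  by (cases "i = 1") (simp_all add: weight_def)

lemma kernel_weight: "kernel_weight weight S X k"
  by (simp add: kernel_weight_def weight_nonneg sum_weight)

text \<open>Either answer has probability between (1 - t)/2 and (1 + t)/2 whatever the datum; the
  seed does not depend on the datum, which 1 <= e covers.\<close>

lemma weight_ratio:
  assumes "(1 + t) / (1 - t) \<le> e"
  shows "weight i x z y \<le> e * weight i x' z y"
proof -
  have e: "1 \<le> e" "1 + t \<le> e * (1 - t)"
    using assms t by (auto simp: field_simps intro: order_trans[OF _ assms])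
  have "a \<le> e * b" if "a \<le> (1 + t) / 2" "(1 - t) / 2 \<le> b" for a b
  proof -
    have "a \<le> e * ((1 - t) / 2)" using e that by simp
    also have "\<dots> \<le> e * b" using e that by (intro mult_left_mono) auto
    finally show ?thesis .
  qed
  moreover have "1 - response A x \<le> (1 + t) / 2" "(1 - t) / 2 \<le> 1 - response A x" for A x
    using response(2,3)[of A x] by (auto simp: field_simps)
  ultimately show ?thesis
    using e response by (auto simp: weight_def bernoulli_weight_def divide_right_mono)
qed

text \<open>Measurability is automatic on finite spaces, and the privacy inequality follows by
  summing the pointwise ratio bound over \<open>A\<close>.\<close>

lemma ldp_mechanism_coin:
  assumes "(1 + t) / (1 - t) \<le> exp \<alpha>"
  shows "ldp_mechanism n d \<alpha> (count_space S) mechanism"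
  unfolding ldp_mechanism_def
proof (intro ballI conjI)
  fix i :: nat
  have "count_space {1..d} \<Otimes>\<^sub>M Pi\<^sub>M {1..<i} (\<lambda>_. count_space S)
      = count_space ({1..d} \<times> ({1..<i} \<rightarrow>\<^sub>E S))"
    using S by (simp add: count_space_PiM_finite countable_finite finite_PiE pair_measure_countable)
  moreover have "prob_space (mechanism j x z)" for j x z
    unfolding mechanism_def using S(1) weight_nonneg sum_weight
    by (rule prob_space_point_measure_real)
  ultimately show "(\<lambda>(x, z). mechanism i x z)
      \<in> count_space {1..d} \<Otimes>\<^sub>M Pi\<^sub>M {1..<i} (\<lambda>_. count_space S) \<rightarrow>\<^sub>M prob_algebra (count_space S)"
    by (auto simp: space_prob_algebra mechanism_def sets_point_measure)
  fix A x x' z assume "A \<in> sets (count_space S)"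
  then have A: "A \<subseteq> S" "finite A" using S by (auto intro: finite_subset)
  have "measure (mechanism i x z) A = (\<Sum>y\<in>A. weight i x z y)" for x
    using A S weight_nonneg
    by (simp add: measure_def mechanism_def emeasure_point_measure_finite sum_ennreal sum_nonneg)
  then show "measure (mechanism i x z) A \<le> exp \<alpha> * measure (mechanism i x' z) A"
    using assms by (simp add: sum_distrib_left sum_mono weight_ratio)
qed

section \<open>Conditional law of the answers given the seed\<close>

lemma mean_bounds:
  assumes "p \<in> prob_vectors d"
  shows "mean p A \<in> {0..1}"
proof -
  have p: "\<And>j. j \<in> {1..d} \<Longrightarrow> 0 \<le> p j" "(\<Sum>j=1..d. p j) = 1"
    using assms by (auto simp: prob_vectors_def PiE_iff)
  have "mean p A \<le> (\<Sum>j=1..d. p j * 1)"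
    unfolding mean_def using p response(1)[of A] by (intro sum_mono mult_left_mono) auto
  moreover have "0 \<le> mean p A"
    unfolding mean_def using p response(1)[of A] by (intro sum_nonneg mult_nonneg_nonneg) auto
  ultimately show ?thesis using p by simp
qed

text \<open>A response is 1/2 plus t/2 times a sign; the constant part cancels because
  \<open>p\<close> and \<open>p0\<close> have equal total mass.\<close>

lemma mean_diff:
  assumes "p \<in> prob_vectors d" "p0 \<in> prob_vectors d"
  shows "mean p A - mean p0 A = t / 2 * signed_sum {1..d} (\<lambda>j. p j - p0 j) A"
proof -
  have "mean p A - mean p0 A = (\<Sum>j=1..d. (p j - p0 j) * response A j)"
    by (simp add: mean_def sum_subtractf algebra_simps)
  also have "\<dots> = (\<Sum>j=1..d. (p j - p0 j) / 2 + t / 2 * (if j \<in> A then p j - p0 j else - (p j - p0 j)))"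
    by (intro sum.cong) (auto simp: response_def field_simps)
  also have "\<dots> = (\<Sum>j=1..d. p j - p0 j) / 2 + t / 2 * signed_sum {1..d} (\<lambda>j. p j - p0 j) A"
    by (simp only: sum.distrib signed_sum_def sum_distrib_left sum_divide_distrib)
  also have "(\<Sum>j=1..d. p j - p0 j) = 0"
    using assms by (simp add: sum_subtractf prob_vectors_def)
  finally show ?thesis by simp
qed

text \<open>Given the seed \<open>w\<close>, the answers of users 2 to n are independent, so their
  conditional law is a product.\<close>

abbreviation "cond_weight p w z \<equiv>
  \<Prod>i\<in>{2..n}. bernoulli_weight (mean p (seed w ((i - 2) div batch_size))) (z i)"

lemma cond_weight_nonneg: "p \<in> prob_vectors d \<Longrightarrow> 0 \<le> cond_weight p w z"
  using mean_bounds by (intro prod_nonneg) (auto intro!: bernoulli_weight_nonneg)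

lemma sum_cond_weight: "(\<Sum>z\<in>{2..n} \<rightarrow>\<^sub>E S. cond_weight p w z) = 1"
  using S sum_bernoulli_weight[OF S, of _ "\<lambda>_. 1"] by (subst prod_sum_PiE[symmetric]) auto

lemma integral_private_law_mechanism:
  assumes p: "p \<in> prob_vectors d"
  shows "(\<integral>z. \<phi> z \<partial>private_law n d (count_space S) mechanism p)
    = (\<Sum>w\<in>S. \<Sum>z\<in>{2..n} \<rightarrow>\<^sub>E S. cond_weight p w z * \<phi> (z(1 := w))) / real (card S)"
proof -
  let ?w = "\<lambda>i z. \<Sum>j=1..d. p j * weight i j (restrict z {1..<i}) (z i)"
  have p1: "(\<Sum>j=1..d. p j) = 1"
    using p by (simp add: prob_vectors_def)
  have I: "{1..n} = insert 1 {2..n}" using n by auto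
  have w1: "?w 1 z = 1 / card S" for z
    using p1 by (simp add: weight_def flip: sum_divide_distrib)
  have w2: "?w i (z(1 := w)) = bernoulli_weight (mean p (seed w ((i - 2) div batch_size))) (z i)"
    if "i \<in> {2..n}" for i z w
  proof -
    let ?A = "seed w ((i - 2) div batch_size)"
    have "?w i (z(1 := w)) = (\<Sum>j=1..d. p j * bernoulli_weight (response ?A j) (z i))"
      using that by (simp add: weight_def)
    \<comment> \<open>\<open>bernoulli_weight\<close> is affine in its parameter at 0 and 1 and
      vanishes elsewhere, so averaging over the datum averages the parameter.\<close>
    also have "\<dots> = bernoulli_weight (mean p ?A) (z i)"
      using p1 by (simp add: bernoulli_weight_def mean_def right_diff_distrib sum_subtractf)
    finally show ?thesis .
  qed
  have w: "(\<Prod>i\<in>insert 1 {2..n}. ?w i (z(1 := w))) = cond_weight p w z / card S" for z w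
    using w1[of "z(1 := w)"] w2 by simp
  have "(\<integral>z. \<phi> z \<partial>private_law n d (count_space S) mechanism p)
      = (\<Sum>z\<in>{1..n} \<rightarrow>\<^sub>E S. (\<Prod>i\<in>{1..n}. ?w i z) * \<phi> z)"
    unfolding mechanism_def[abs_def] using S kernel_weight p
    by (intro integral_private_law) auto
  also have "\<dots> = (\<Sum>w\<in>S. \<Sum>z\<in>{2..n} \<rightarrow>\<^sub>E S. (\<Prod>i\<in>insert 1 {2..n}. ?w i (z(1 := w))) * \<phi> (z(1 := w)))"
    unfolding I by (rule sum_PiE_insert) simp
  also have "\<dots> = (\<Sum>w\<in>S. \<Sum>z\<in>{2..n} \<rightarrow>\<^sub>E S. cond_weight p w z * \<phi> (z(1 := w)) / card S)"
    by (simp only: w times_divide_eq_left)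
  finally show ?thesis
    by (simp only: sum_divide_distrib)
qed

section \<open>Error probabilities of the coin test\<close>

lemma batch_subset: "b < m \<Longrightarrow> batch b \<subseteq> {2..n}"
proof
  fix i assume "b < m" "i \<in> batch b"
  then have "i < 2 + (b + 1) * batch_size" "2 \<le> i" by (auto simp: batch_def)
  moreover have "(b + 1) * batch_size \<le> m * batch_size"
    using \<open>b < m\<close> by (intro mult_right_mono) auto
  moreover have "m * batch_size \<le> n - 1"
    by (simp add: batch_size_def)
  ultimately show "i \<in> {2..n}" by auto
qed

lemma batch_index: "i \<in> batch b \<Longrightarrow> (i - 2) div batch_size = b"
  by (auto simp: batch_def mult.commute intro!: div_nat_eqI)

text \<open>Chebyshev's inequality for one batch, around its own mean under \<open>p\<close>. It
  holds for every fixed seed and serves both the null and the alternative.\<close>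

lemma batch_error:
  assumes p: "p \<in> prob_vectors d" and b: "b < m" and "0 < batch_size" "0 < \<tau>"
  shows "(\<Sum>z\<in>{2..n} \<rightarrow>\<^sub>E S. cond_weight p w z * of_bool (real batch_size * \<tau>
      \<le> \<bar>(\<Sum>i\<in>batch b. z i) - real batch_size * mean p (seed w b)\<bar>))
    \<le> 1 / (4 * real batch_size * \<tau>\<^sup>2)"
proof -
  let ?\<theta> = "\<lambda>i. mean p (seed w ((i - 2) div batch_size))"
  have card: "card (batch b) = batch_size" by (simp add: batch_def)
  have "(\<Sum>i\<in>batch b. ?\<theta> i) = (\<Sum>i\<in>batch b. mean p (seed w b))"
    by (intro sum.cong) (auto simp: batch_index)
  then have "(\<Sum>i\<in>batch b. ?\<theta> i) = real batch_size * mean p (seed w b)"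
    by (simp add: card)
  then show ?thesis
    using bernoulli_chebyshev[OF S, of "{2..n}" "batch b" ?\<theta> "real batch_size * \<tau>"]
      batch_subset[OF b] mean_bounds[OF p] assms(3,4)
    by (simp add: card power2_eq_square field_simps)
qed

lemma coin_test_upd: "coin_test p0 \<tau> (z(1 := w)) = of_bool (\<exists>b<m. real batch_size * \<tau>
    \<le> \<bar>(\<Sum>i\<in>batch b. z i) - real batch_size * mean p0 (seed w b)\<bar>)"
proof -
  have "(\<Sum>i\<in>batch b. (z(1 := w)) i) = (\<Sum>i\<in>batch b. z i)" for b
    by (intro sum.cong) (auto simp: batch_def)
  then show ?thesis by (simp add: coin_test_def)
qed

text \<open>A union bound over the batches, uniformly in the seed.\<close>

lemma type_I_error:
  assumes p0: "p0 \<in> prob_vectors d" and pos: "0 < batch_size" "0 < \<tau>"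
  shows "(\<integral>z. coin_test p0 \<tau> z \<partial>private_law n d (count_space S) mechanism p0)
    \<le> real m / (4 * real batch_size * \<tau>\<^sup>2)"
proof -
  let ?P = "\<lambda>b w z. real batch_size * \<tau>
    \<le> \<bar>(\<Sum>i\<in>batch b. z i) - real batch_size * mean p0 (seed w b)\<bar>"
  have "(\<Sum>z\<in>{2..n} \<rightarrow>\<^sub>E S. cond_weight p0 w z * coin_test p0 \<tau> (z(1 := w)))
      \<le> real m / (4 * real batch_size * \<tau>\<^sup>2)" for w
  proof -
    have union: "of_bool (\<exists>b<m. ?P b w z) \<le> (\<Sum>b<m. of_bool (?P b w z) :: real)" for z
    proof (cases "\<exists>b<m. ?P b w z")
      case True
      then obtain b where "b \<in> {..<m}" "?P b w z" by auto
      then show ?thesis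
        using member_le_sum[of b "{..<m}" "\<lambda>b. of_bool (?P b w z) :: real"] by simp
    qed (simp add: sum_nonneg)
    have "(\<Sum>z\<in>{2..n} \<rightarrow>\<^sub>E S. cond_weight p0 w z * coin_test p0 \<tau> (z(1 := w)))
        \<le> (\<Sum>z\<in>{2..n} \<rightarrow>\<^sub>E S. cond_weight p0 w z * (\<Sum>b<m. of_bool (?P b w z)))"
      unfolding coin_test_upd using union cond_weight_nonneg[OF p0]
      by (intro sum_mono mult_left_mono) auto
    also have "\<dots> = (\<Sum>b<m. \<Sum>z\<in>{2..n} \<rightarrow>\<^sub>E S. cond_weight p0 w z * of_bool (?P b w z))"
      by (simp only: sum_distrib_left sum.swap[of _ "{..<m}"])
    also have "\<dots> \<le> (\<Sum>b<m. 1 / (4 * real batch_size * \<tau>\<^sup>2))"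
      using batch_error[OF p0 _ pos] by (intro sum_mono) auto
    finally show ?thesis by simp
  qed
  then have "(\<Sum>w\<in>S. \<Sum>z\<in>{2..n} \<rightarrow>\<^sub>E S. cond_weight p0 w z * coin_test p0 \<tau> (z(1 := w)))
      \<le> real (card S) * (real m / (4 * real batch_size * \<tau>\<^sup>2))"
    by (intro sum_bounded_above) auto
  then show ?thesis
    using card_S(2) unfolding integral_private_law_mechanism[OF p0] by (simp add: field_simps)
qed

text \<open>\<open>seed\<close> is a bijection, so the subsets of different batches are independent;
  bad seeds inject into the m-th power of the subsets that are bad for one batch.\<close>

lemma card_bad_seeds:
  assumes V: "V = (\<Sum>j=1..d. (v j)\<^sup>2)" "0 < V"
  shows "real (card {w \<in> S. \<forall>b<m. (signed_sum {1..d} v (seed w b))\<^sup>2 < V / 4})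
    \<le> (4 / 5) ^ m * real (card S)"
proof -
  let ?B = "{A \<in> Pow {1..d}. (signed_sum {1..d} v A)\<^sup>2 < V / 4}"
  let ?W = "{w \<in> S. \<forall>b<m. (signed_sum {1..d} v (seed w b))\<^sup>2 < V / 4}"
  have "seed ` ?W \<subseteq> {..<m} \<rightarrow>\<^sub>E ?B"
  proof
    fix u assume "u \<in> seed ` ?W"
    then obtain w where w: "w \<in> ?W" "u = seed w" by auto
    then have "seed w \<in> {..<m} \<rightarrow>\<^sub>E Pow {1..d}"
      using bij_betwE[OF seed] by blast
    with w show "u \<in> {..<m} \<rightarrow>\<^sub>E ?B" by (auto simp: PiE_iff)
  qed
  moreover have "finite ({..<m} \<rightarrow>\<^sub>E ?B)" by (intro finite_PiE) auto
  moreover have "inj_on seed ?W"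
    using seed by (auto simp: bij_betw_def intro: inj_on_subset)
  ultimately have "card ?W \<le> card ({..<m} \<rightarrow>\<^sub>E ?B)"
    by (intro card_inj_on_le)
  then have "real (card ?W) \<le> real (card ?B) ^ m"
    by (simp add: card_PiE flip: of_nat_power)
  also have "\<dots> \<le> (4 / 5 * 2 ^ card {1..d}) ^ m"
    using card_small_signed_sum[OF _ V] by (intro power_mono) auto
  finally show ?thesis
    by (simp add: card_S power_mult_distrib power_mult power_divide)
qed

text \<open>Either the seed is bad for all batches, or some batch has means at least 2 \<tau> apart;
  then acceptance forces that batch to deviate by \<tau> from its mean under
  \<open>p\<close>.\<close>

lemma type_II_error:
  assumes p0: "p0 \<in> prob_vectors d" and p: "p \<in> prob_vectors d" and pos: "0 < batch_size" "0 < \<tau>"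
    and V: "V = (\<Sum>j=1..d. (p j - p0 j)\<^sup>2)" "(8 * \<tau> / t)\<^sup>2 \<le> V"
  shows "(\<integral>z. 1 - coin_test p0 \<tau> z \<partial>private_law n d (count_space S) mechanism p)
    \<le> (4 / 5) ^ m + 1 / (4 * real batch_size * \<tau>\<^sup>2)"
proof -
  let ?Y = "signed_sum {1..d} (\<lambda>j. p j - p0 j)"
  let ?err = "1 / (4 * real batch_size * \<tau>\<^sup>2)"
  let ?bad = "\<lambda>w. \<forall>b<m. (?Y (seed w b))\<^sup>2 < V / 4"
  have V0: "0 < V"
    using V(2) pos t by (intro less_le_trans[OF _ V(2)]) auto
  have cond: "(\<Sum>z\<in>{2..n} \<rightarrow>\<^sub>E S. cond_weight p w z * (1 - coin_test p0 \<tau> (z(1 := w))))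
      \<le> of_bool (?bad w) + ?err" for w
  proof (cases "?bad w")
    case True
    have "(\<Sum>z\<in>{2..n} \<rightarrow>\<^sub>E S. cond_weight p w z * (1 - coin_test p0 \<tau> (z(1 := w))))
        \<le> (\<Sum>z\<in>{2..n} \<rightarrow>\<^sub>E S. cond_weight p w z * 1)"
      using cond_weight_nonneg[OF p] by (intro sum_mono mult_left_mono) (auto simp: coin_test_def)
    also have "\<dots> = 1" using sum_cond_weight by simp
    finally show ?thesis using True pos by (simp add: add_increasing2)
  next
    case False
    then obtain b where b: "b < m" "V / 4 \<le> (?Y (seed w b))\<^sup>2" by (auto simp: not_less)
    let ?A = "seed w b"
    \<comment> \<open>Since \<open>?Y\<close> is at least sqrt V / 2 in modulus and the means differ
      by t/2 times \<open>?Y\<close>, the constant 8 in the hypothesis leaves 2 \<tau>.\<close>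
    have "(4 * \<tau> / t)\<^sup>2 \<le> (?Y ?A)\<^sup>2"
      using V(2) b(2) by (simp add: power2_eq_square)
    then have "4 * \<tau> / t \<le> \<bar>?Y ?A\<bar>"
      using pos t by (simp add: abs_le_square_iff[symmetric])
    then have "2 * \<tau> \<le> \<bar>mean p ?A - mean p0 ?A\<bar>"
      using t by (simp add: mean_diff[OF p p0] abs_mult field_simps)
    then have gap: "real batch_size * (2 * \<tau>) \<le> \<bar>real batch_size * mean p ?A - real batch_size * mean p0 ?A\<bar>"
      using pos by (simp add: abs_mult flip: right_diff_distrib)
    have "1 - coin_test p0 \<tau> (z(1 := w)) \<le> of_bool (real batch_size * \<tau>
        \<le> \<bar>(\<Sum>i\<in>batch b. z i) - real batch_size * mean p ?A\<bar>)" for z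
    proof (cases "real batch_size * \<tau> \<le> \<bar>(\<Sum>i\<in>batch b. z i) - real batch_size * mean p ?A\<bar>")
      case True
      then show ?thesis by (simp add: coin_test_def)
    next
      case False
      \<comment> \<open>Triangle inequality: an answer count within \<tau> of one mean per user is
        at least \<tau> away from the other.\<close>
      then have "real batch_size * \<tau> \<le> \<bar>(\<Sum>i\<in>batch b. z i) - real batch_size * mean p0 ?A\<bar>"
        using gap by (simp only: distrib_left mult_2)
      with b(1) have "coin_test p0 \<tau> (z(1 := w)) = 1"
        unfolding coin_test_upd by auto
      then show ?thesis by simp
    qed
    then have "(\<Sum>z\<in>{2..n} \<rightarrow>\<^sub>E S. cond_weight p w z * (1 - coin_test p0 \<tau> (z(1 := w))))
        \<le> (\<Sum>z\<in>{2..n} \<rightarrow>\<^sub>E S. cond_weight p w z * of_bool (real batch_size * \<tau>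
          \<le> \<bar>(\<Sum>i\<in>batch b. z i) - real batch_size * mean p ?A\<bar>))"
      using cond_weight_nonneg[OF p] by (intro sum_mono mult_left_mono) auto
    also have "\<dots> \<le> ?err"
      by (rule batch_error[OF p b(1) pos])
    finally show ?thesis by simp
  qed
  have "(\<Sum>w\<in>S. \<Sum>z\<in>{2..n} \<rightarrow>\<^sub>E S. cond_weight p w z * (1 - coin_test p0 \<tau> (z(1 := w))))
      \<le> (\<Sum>w\<in>S. of_bool (?bad w) + ?err)"
    using cond by (intro sum_mono) auto
  also have "\<dots> = real (card {w \<in> S. ?bad w}) + real (card S) * ?err"
    using S(1) by (simp add: sum.distrib Int_def)
  also have "\<dots> \<le> ((4 / 5) ^ m + ?err) * real (card S)"
    using card_bad_seeds[OF V(1) V0] by (simp add: algebra_simps)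
  finally show ?thesis
    using card_S(2) unfolding integral_private_law_mechanism[OF p] by (simp add: pos_divide_le_eq)
qed

lemma coin_test_private: "coin_test p0 \<tau> \<in> private_tests n (count_space S)"
  using borel_measurable_PiM_finite[OF S(1)] by (auto simp: private_tests_def coin_test_def)

end

text \<open>Private data have to be reals, so the seeds are coded as 0, 1, 2, and so on. As d m >= 1
  there are at least two codes, which puts both answers 0 and 1 into the alphabet.\<close>

lemma ex_public_coin:
  assumes "1 \<le> n" "1 \<le> d" "1 \<le> m" "0 < t" "t < 1"
  shows "\<exists>S seed. public_coin n d m t S seed"
proof -
  define \<Omega> where "\<Omega> = {..<m} \<rightarrow>\<^sub>E Pow {1..d}"
  have fin: "finite \<Omega>" unfolding \<Omega>_def by (intro finite_PiE) auto
  have card: "card \<Omega> = 2 ^ (d * m)"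
    by (simp add: \<Omega>_def card_PiE card_Pow power_mult)
  have "d * m \<noteq> 0" using assms by simp
  then have "1 < card \<Omega>"
    unfolding card by (intro one_less_power) auto
  obtain h where h: "bij_betw h {0..<card \<Omega>} \<Omega>"
    using ex_bij_betw_nat_finite[OF fin] by blast
  let ?S = "real ` {0..<card \<Omega>}"
  have "bij_betw real {0..<card \<Omega>} ?S"
    by (auto simp: bij_betw_def inj_on_def)
  then have "bij_betw (h \<circ> inv_into {0..<card \<Omega>} real) ?S \<Omega>"
    using h by (blast intro: bij_betw_trans bij_betw_inv_into)
  moreover have "0 \<in> ?S" "1 \<in> ?S"
    using \<open>1 < card \<Omega>\<close> by (auto simp: image_iff intro: bexI[of _ 0] bexI[of _ 1])
  ultimately have "public_coin n d m t ?S (h \<circ> inv_into {0..<card \<Omega>} real)"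
    using assms unfolding \<Omega>_def by unfold_locales auto
  then show ?thesis by blast
qed

subsection \<open>Testing radii\<close>

text \<open>Both \<open>p j + p0 j\<close> and 1 bound the modulus of the difference. The bound is
  what excludes alternatives when n is small.\<close>

lemma prob_vectors_sq_dist_le:
  assumes "p \<in> prob_vectors d" "p0 \<in> prob_vectors d"
  shows "(\<Sum>j=1..d. (p j - p0 j)\<^sup>2) \<le> 2"
proof -
  have "(p j - p0 j)\<^sup>2 \<le> p j + p0 j" if "j \<in> {1..d}" for j
  proof -
    have b: "p j \<in> {0..1}" "p0 j \<in> {0..1}"
      using assms that by (auto simp: prob_vectors_def PiE_iff)
    then have "\<bar>p j - p0 j\<bar> * \<bar>p j - p0 j\<bar> \<le> (p j + p0 j) * 1"
      by (intro mult_mono) auto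
    then show ?thesis by (simp add: power2_eq_square)
  qed
  then have "(\<Sum>j=1..d. (p j - p0 j)\<^sup>2) \<le> (\<Sum>j=1..d. p j + p0 j)"
    by (intro sum_mono) auto
  also have "\<dots> = 2"
    using assms by (simp add: sum.distrib prob_vectors_def)
  finally show ?thesis .
qed

text \<open>The lower bound makes it unlikely that all batches miss, the upper bound limits the
  sampling error. Rounding up sqrt (200 / \<gamma>) works, because (s + 1)^2 <= 2 s^2 + 2 gives 400
  + 2.\<close>

lemma ex_number_of_batches:
  fixes \<gamma> :: real
  assumes "0 < \<gamma>" "\<gamma> < 1"
  shows "\<exists>m. 2 \<le> m \<and> 200 \<le> (real m)\<^sup>2 * \<gamma> \<and> (real m)\<^sup>2 * \<gamma> \<le> 402"
proof -
  define s where "s = sqrt (200 / \<gamma>)"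
  define m where "m = nat \<lceil>s\<rceil>"
  have s2: "s\<^sup>2 = 200 / \<gamma>" using assms by (simp add: s_def)
  have "4 \<le> 200 / \<gamma>" using assms by (simp add: field_simps)
  then have "sqrt 4 \<le> s" unfolding s_def by (rule real_sqrt_le_mono)
  then have s: "2 \<le> s" by simp
  then have m: "s \<le> m" "m \<le> s + 1" unfolding m_def by linarith+
  have "s\<^sup>2 \<le> (real m)\<^sup>2" using s m by (intro power_mono) auto
  then have lower: "200 \<le> (real m)\<^sup>2 * \<gamma>" using assms unfolding s2 by (simp add: field_simps)
  have "(real m)\<^sup>2 \<le> (s + 1)\<^sup>2" using s m by (intro power_mono) auto
  also have "\<dots> \<le> 2 * s\<^sup>2 + 2" using zero_le_power2[of "s - 1"] by (simp add: power2_eq_square algebra_simps)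
  also have "\<dots> * \<gamma> \<le> 402" using assms unfolding s2 by (simp add: field_simps)
  finally have "(real m)\<^sup>2 * \<gamma> \<le> 402"
    using assms by (simp add: mult_right_mono)
  moreover have "2 \<le> m" using s m by linarith
  ultimately show ?thesis using lower by blast
qed

text \<open>Follows from 4/5 <= exp (-1/5) and the quadratic Taylor bound. Quadratic decay suffices,
  as m is of order 1 / sqrt \<gamma>.\<close>

lemma four_fifths_power_le:
  assumes "0 < m"
  shows "(4 / 5 :: real) ^ m \<le> 50 / (real m)\<^sup>2"
proof -
  have "1 + real m / 5 + (real m / 5)\<^sup>2 / 2 \<le> exp (real m / 5)"
    by (rule exp_lower_Taylor_quadratic) simp
  then have "(real m)\<^sup>2 / 50 \<le> exp (real m / 5)"
    by (simp add: power2_eq_square)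
  have "(4 / 5 :: real) ^ m \<le> exp (- 1 / 5) ^ m"
    using exp_ge_add_one_self[of "- 1 / 5"] by (intro power_mono) auto
  also have "\<dots> = inverse (exp (real m / 5))"
    by (simp flip: exp_of_nat_mult exp_minus)
  also have "\<dots> \<le> inverse ((real m)\<^sup>2 / 50)"
    using \<open>(real m)\<^sup>2 / 50 \<le> exp (real m / 5)\<close> assms by (intro le_imp_inverse_le) auto
  finally show ?thesis by simp
qed

lemma private_riskI:
  fixes Z :: "real measure"
  assumes "ldp_mechanism n d \<alpha> Z Q" "\<phi> \<in> private_tests n Z"
    and "\<And>p. p \<in> alternatives r d p0 \<delta> \<Longrightarrow>
      (\<integral>z. \<phi> z \<partial>private_law n d Z Q p0) + (\<integral>z. 1 - \<phi> z \<partial>private_law n d Z Q p) \<le> \<gamma>"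
  shows "private_risk r n d \<alpha> p0 \<delta> \<le> ennreal \<gamma>"
proof -
  have "private_risk r n d \<alpha> p0 \<delta> \<le> mechanism_risk r n d p0 \<delta> Z Q"
    unfolding private_risk_def using assms(1) by (auto intro: INF_lower2[of "(Z, Q)"])
  also have "\<dots> \<le> ennreal \<gamma>"
    unfolding mechanism_risk_def using assms(2,3)
    by (intro INF_lower2[OF assms(2)] SUP_least ennreal_leI)
  finally show ?thesis .
qed

text \<open>The type I error, the bad seeds and the sampling error under the alternative each
  receive \<gamma>/4.\<close>

lemma private_risk_L2_le:
  assumes \<gamma>: "0 < \<gamma>" "\<gamma> < 1" and n: "1 \<le> n" and d: "1 \<le> d" and p0: "p0 \<in> prob_vectors d"
    and \<alpha>: "0 < \<alpha>" "\<alpha> \<le> 1"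
  shows "private_risk 2 n d \<alpha> p0 (1000 / sqrt (real n * \<alpha>\<^sup>2 * \<gamma>\<^sup>2)) \<le> ennreal \<gamma>"
proof -
  define D where "D = real n * \<alpha>\<^sup>2 * \<gamma>\<^sup>2"
  define \<delta> where "\<delta> = 1000 / sqrt D"
  \<comment> \<open>For \<alpha> <= 1 this gives (1 + t)/(1 - t) <= 1 + \<alpha> <= exp
    \<alpha>.\<close>
  define t where "t = \<alpha> / 4"
  \<comment> \<open>Chosen so that 8 \<tau> / t = \<delta>, the separation required by
    \<open>type_II_error\<close>.\<close>
  define \<tau> where "\<tau> = \<alpha> * \<delta> / 32"
  have D: "0 < D" using \<gamma> n \<alpha> by (simp add: D_def)
  then have \<delta>: "0 < \<delta>" "\<delta>\<^sup>2 = 1000000 / D" by (auto simp: \<delta>_def power_divide)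
  have \<tau>: "0 < \<tau>" using \<delta> \<alpha> by (simp add: \<tau>_def)
  have t: "0 < t" "t < 1" using \<alpha> by (auto simp: t_def)
  obtain m where m: "2 \<le> m" "200 \<le> (real m)\<^sup>2 * \<gamma>" "(real m)\<^sup>2 * \<gamma> \<le> 402"
    using ex_number_of_batches[OF \<gamma>] by blast
  obtain S seed where "public_coin n d m t S seed"
    using ex_public_coin[OF n d _ t, of m] m by auto
  then interpret public_coin n d m t S seed .
  have "1 + t \<le> (1 + \<alpha>) * (1 - t)"
    using \<alpha> mult_left_mono[of \<alpha> 1 \<alpha>] by (simp add: t_def field_simps)
  also have "\<dots> \<le> exp \<alpha> * (1 - t)"
    using t exp_ge_add_one_self[of \<alpha>] by (intro mult_right_mono) auto
  finally have ratio: "(1 + t) / (1 - t) \<le> exp \<alpha>"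
    using t by (simp add: field_simps)
  show ?thesis
    unfolding D_def[symmetric] \<delta>_def[symmetric]
  proof (rule private_riskI[OF ldp_mechanism_coin[OF ratio] coin_test_private[of p0 \<tau>]])
    fix p assume p: "p \<in> alternatives 2 d p0 \<delta>"
    let ?V = "\<Sum>j=1..d. (p j - p0 j)\<^sup>2"
    let ?N = "real batch_size"
    have pv: "p \<in> prob_vectors d" and "\<delta> \<le> sqrt ?V"
      using p by (auto simp: alternatives_def lnorm_def sqrt_def)
    then have V: "\<delta>\<^sup>2 \<le> ?V"
      using \<delta>(1) power_mono[of \<delta> "sqrt ?V" 2] by (simp add: sum_nonneg)
    \<comment> \<open>The mere existence of an alternative bounds \<delta>, hence forces n to be
      large; for smaller n there is nothing to show.\<close>
    have "1000000 / D \<le> 2"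
      using V prob_vectors_sq_dist_le[OF pv p0] \<delta>(2) by linarith
    then have "500000 \<le> D" using D by (simp add: field_simps)
    also have "D \<le> real n * 1 * \<gamma>\<^sup>2"
      unfolding D_def using \<alpha> by (intro mult_right_mono mult_left_mono) (auto simp: power_le_one)
    finally have n\<gamma>: "500000 \<le> real n * \<gamma>\<^sup>2" by simp
    have "((real m)\<^sup>2 * \<gamma>) * \<gamma> \<le> 402 * 1"
      using m(3) \<gamma> by (intro mult_mono) auto
    then have "(real m)\<^sup>2 * \<gamma>\<^sup>2 \<le> 402" by (simp add: power2_eq_square)
    then have "(real m)\<^sup>2 * \<gamma>\<^sup>2 \<le> real n * \<gamma>\<^sup>2" using n\<gamma> by linarith
    then have "(real m)\<^sup>2 \<le> real n" using \<gamma> by simp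
    then have "m * m \<le> n" by (simp add: power2_eq_square flip: of_nat_mult)
    moreover have "2 * m \<le> m * m" using m(1) by simp
    \<comment> \<open>With m <= n/2, rounding down in \<open>batch_size\<close> costs at most a
      factor 2: n <= m \<open>?N\<close> + m yields n <= 2 m \<open>?N\<close>.\<close>
    ultimately have mn: "2 * m \<le> n" by linarith
    have "n - 1 < m * (batch_size + 1)"
      unfolding batch_size_def using m(1) by (simp add: dividend_less_times_div)
    then have "n \<le> m * (batch_size + 1)" by simp
    then have "real n \<le> real m * (?N + 1)"
      by (metis of_nat_1 of_nat_add of_nat_le_iff of_nat_mult)
    then have N: "real n \<le> 2 * real m * ?N" using mn by (simp add: algebra_simps)
    have N0: "0 < batch_size"
      using N n by (cases "batch_size = 0") auto
    \<comment> \<open>As \<open>?N / real n\<close> is at least 1/(2m), the result is at least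
      4000000/2048 > 1953 times 1/(m \<gamma>^2).\<close>
    have N\<tau>: "4 * ?N * \<tau>\<^sup>2 = 4 * ?N * \<alpha>\<^sup>2 * 1000000 / (1024 * D)"
      by (simp add: \<tau>_def power_divide power_mult_distrib \<delta>(2))
    also have "\<dots> = ?N / real n * (4000000 / (1024 * \<gamma>\<^sup>2))"
      using \<alpha> n \<gamma> by (simp add: D_def field_simps)
    also have "\<dots> \<ge> 1 / (2 * real m) * (4000000 / (1024 * \<gamma>\<^sup>2))"
      using N n m(1) by (intro mult_right_mono) (auto simp: field_simps)
    finally have "1 / (2 * real m) * (4000000 / (1024 * \<gamma>\<^sup>2)) \<le> 4 * ?N * \<tau>\<^sup>2" .
    then have "1953 / (real m * \<gamma>\<^sup>2) \<le> 4 * ?N * \<tau>\<^sup>2"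
      using m(1) \<gamma> by (elim order_trans[rotated]) (simp add: field_simps)
    then have "1 / (4 * ?N * \<tau>\<^sup>2) \<le> 1 / (1953 / (real m * \<gamma>\<^sup>2))"
      using m(1) \<gamma> N0 \<tau> by (intro divide_left_mono mult_pos_pos divide_pos_pos) auto
    then have err: "1 / (4 * ?N * \<tau>\<^sup>2) \<le> real m * \<gamma>\<^sup>2 / 1953" by simp
    have err1: "real m / (4 * ?N * \<tau>\<^sup>2) \<le> \<gamma> / 4"
    proof -
      have "real m / (4 * ?N * \<tau>\<^sup>2) \<le> real m * (real m * \<gamma>\<^sup>2 / 1953)"
        using mult_left_mono[OF err, of "real m"] by simp
      also have "\<dots> = ((real m)\<^sup>2 * \<gamma>) * \<gamma> / 1953" by (simp add: power2_eq_square)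
      also have "\<dots> \<le> 402 * \<gamma> / 1953"
        using m(3) \<gamma> by (intro divide_right_mono mult_right_mono) auto
      also have "\<dots> \<le> \<gamma> / 4" using \<gamma> by simp
      finally show ?thesis .
    qed
    have "1 * (1 / (4 * ?N * \<tau>\<^sup>2)) \<le> real m * (1 / (4 * ?N * \<tau>\<^sup>2))"
      using m(1) by (intro mult_right_mono) auto
    then have "1 / (4 * ?N * \<tau>\<^sup>2) \<le> real m / (4 * ?N * \<tau>\<^sup>2)" by simp
    then have err2: "1 / (4 * ?N * \<tau>\<^sup>2) \<le> \<gamma> / 4" using err1 by (rule order_trans)
    have "(4 / 5) ^ m \<le> 50 / (real m)\<^sup>2"
      using m(1) by (intro four_fifths_power_le) simp
    also have "\<dots> \<le> \<gamma> / 4"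
      using m(1,2) by (simp add: field_simps)
    finally have bad: "(4 / 5) ^ m \<le> \<gamma> / 4" .
    have "8 * \<tau> / t = \<delta>" using \<alpha> by (simp add: \<tau>_def t_def)
    then have "(\<integral>z. 1 - coin_test p0 \<tau> z \<partial>private_law n d (count_space S) mechanism p)
        \<le> (4 / 5) ^ m + 1 / (4 * ?N * \<tau>\<^sup>2)"
      using V by (intro type_II_error[OF p0 pv N0 \<tau> refl]) simp
    moreover have "(\<integral>z. coin_test p0 \<tau> z \<partial>private_law n d (count_space S) mechanism p0)
        \<le> real m / (4 * ?N * \<tau>\<^sup>2)"
      by (rule type_I_error[OF p0 N0 \<tau>])
    ultimately show "(\<integral>z. coin_test p0 \<tau> z \<partial>private_law n d (count_space S) mechanism p0)
        + (\<integral>z. 1 - coin_test p0 \<tau> z \<partial>private_law n d (count_space S) mechanism p) \<le> \<gamma>"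
      using err1 err2 bad \<gamma> by linarith
  qed
qed

section \<open>From risks to radii and from L2 to L1\<close>

lemma testing_radius_le:
  assumes "0 < \<delta>" "private_risk r n d \<alpha> p0 \<delta> \<le> ennreal \<gamma>"
  shows "testing_radius r n d \<alpha> \<gamma> p0 \<le> \<delta>"
  unfolding testing_radius_def using assms by (intro cInf_lower bdd_belowI[of _ 0]) auto

text \<open>For a fixed mechanism and test, fewer alternatives mean a smaller supremum. The norms
  may differ, which transfers the L2 test to L1.\<close>

lemma private_risk_antimono:
  assumes "alternatives r d p0 \<delta> \<subseteq> alternatives r' d p0 \<delta>'"
  shows "private_risk r n d \<alpha> p0 \<delta> \<le> private_risk r' n d \<alpha> p0 \<delta>'"
proof -
  have "mechanism_risk r n d p0 \<delta> Z Q \<le> mechanism_risk r' n d p0 \<delta>' Z Q" for Z :: "real measure" and Q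
    unfolding mechanism_risk_def using assms by (intro INF_mono' SUP_subset_mono) auto
  then show ?thesis
    unfolding private_risk_def by (intro INF_mono') auto
qed

text \<open>The mass of \<open>p - p0\<close> outside \<open>B\<close> is at most \<open>2 * p0(B\<^sup>c)\<close> plus its mass inside \<open>B\<close>,
  because the total masses of \<open>p\<close> and \<open>p0\<close> agree; on \<open>B\<close> apply the Cauchy--Schwarz inequality.\<close>

lemma alternatives_L1_subset_L2:
  assumes p0: "p0 \<in> prob_vectors d" and B: "B \<noteq> {}" "B \<subseteq> {1..d}" and "0 < s" "1 \<le> C"
  shows "alternatives 1 d p0 (4 * C * max (sqrt (card B) * s) (\<Sum>j\<in>{1..d} - B. p0 j))
    \<subseteq> alternatives 2 d p0 (C * s)"
proof
  fix p assume p: "p \<in> alternatives 1 d p0 (4 * C * max (sqrt (card B) * s) (\<Sum>j\<in>{1..d} - B. p0 j))"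
  let ?B' = "{1..d} - B" and ?v = "\<lambda>j. p j - p0 j"
  let ?T = "\<Sum>j\<in>B. \<bar>?v j\<bar>"
  define M where "M = max (sqrt (card B) * s) (\<Sum>j\<in>?B'. p0 j)"
  have pv: "p \<in> prob_vectors d" and M: "4 * C * M \<le> (\<Sum>j=1..d. \<bar>?v j\<bar>)"
    using p unfolding M_def by (auto simp: alternatives_def lnorm_def)
  have fin: "finite B" using B(2) by (rule finite_subset) simp
  have split: "(\<Sum>j=1..d. f j) = (\<Sum>j\<in>?B'. f j) + (\<Sum>j\<in>B. f j)" for f :: "nat \<Rightarrow> real"
    using B(2) by (intro sum.subset_diff) auto
  have card: "0 < sqrt (card B)" using B(1) fin by (simp add: card_gt_0_iff)
  have "0 < M" unfolding M_def using card \<open>0 < s\<close> by (simp add: less_max_iff_disj)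
  have pos: "0 \<le> p j" "0 \<le> p0 j" if "j \<in> {1..d}" for j
    using p0 pv that by (auto simp: prob_vectors_def PiE_iff)
  have "(\<Sum>j\<in>?B'. \<bar>?v j\<bar>) \<le> (\<Sum>j\<in>?B'. p j + p0 j)"
    using pos by (intro sum_mono) (auto simp: abs_le_iff intro: order_trans[OF _ add_increasing2] add_increasing)
  also have "\<dots> = 2 * (\<Sum>j\<in>?B'. p0 j) + (\<Sum>j\<in>?B'. ?v j)"
    by (simp add: sum.distrib sum_subtractf)
  also have "(\<Sum>j\<in>?B'. ?v j) = - (\<Sum>j\<in>B. ?v j)"
    using split[of ?v] p0 pv by (simp add: sum_subtractf prob_vectors_def)
  also have "- (\<Sum>j\<in>B. ?v j) \<le> ?T"
    using sum_abs[of ?v B] by linarith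
  finally have "(\<Sum>j=1..d. \<bar>?v j\<bar>) \<le> 2 * (\<Sum>j\<in>?B'. p0 j) + 2 * ?T"
    unfolding split[of "\<lambda>j. \<bar>?v j\<bar>"] by linarith
  also have "(\<Sum>j\<in>?B'. p0 j) \<le> M" by (simp add: M_def)
  \<comment> \<open>The factor 4 leaves 2 C M for the mass on \<open>B\<close> after 2 M <= 2 C M is
    spent on the tail.\<close>
  finally have "4 * C * M \<le> 2 * M + 2 * ?T" using M by linarith
  moreover have "1 * M \<le> C * M" using \<open>1 \<le> C\<close> \<open>0 < M\<close> by (intro mult_right_mono) auto
  ultimately have T: "C * M \<le> ?T" by linarith
  have "sqrt (card B) * (C * s) = C * (sqrt (card B) * s)" by simp
  also have "\<dots> \<le> C * M" using \<open>1 \<le> C\<close> by (intro mult_left_mono) (auto simp: M_def)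
  also note T
  also have "?T = (\<Sum>j\<in>B. \<bar>1\<bar> * \<bar>?v j\<bar>)" by simp
  also have "\<dots> \<le> L2_set (\<lambda>_. 1) B * L2_set ?v B" by (rule L2_set_mult_ineq)
  also have "L2_set (\<lambda>_. 1) B = sqrt (card B)" by (simp add: L2_set_def)
  finally have "C * s \<le> L2_set ?v B" using card by simp
  also have "\<dots> \<le> L2_set ?v {1..d}"
    unfolding L2_set_def using B(2) by (intro real_sqrt_le_mono sum_mono2) auto
  also have "\<dots> = lnorm 2 d ?v" by (simp add: L2_set_def lnorm_def sqrt_def)
  finally show "p \<in> alternatives 2 d p0 (C * s)"
    using pv by (simp add: alternatives_def)
qed

text \<open>The constant is the 4 of the inclusion of alternatives times the 1000 of the L2
  bound.\<close>

lemma testing_radius_L1_le: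
  assumes \<gamma>: "0 < \<gamma>" "\<gamma> < 1" and n: "1 \<le> n" and d: "1 \<le> d" and p0: "p0 \<in> prob_vectors d"
    and \<alpha>: "0 < \<alpha>" "\<alpha> \<le> 1" and B: "B \<noteq> {}" "B \<subseteq> {1..d}"
  shows "testing_radius 1 n d \<alpha> \<gamma> p0
    \<le> 4000 * max (sqrt (real (card B)) / sqrt (real n * \<alpha>\<^sup>2 * \<gamma>\<^sup>2)) (\<Sum>j\<in>{1..d} - B. p0 j)"
proof (rule testing_radius_le)
  let ?s = "1 / sqrt (real n * \<alpha>\<^sup>2 * \<gamma>\<^sup>2)"
  let ?\<delta> = "4000 * max (sqrt (real (card B)) / sqrt (real n * \<alpha>\<^sup>2 * \<gamma>\<^sup>2)) (\<Sum>j\<in>{1..d} - B. p0 j)"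
  have s: "0 < ?s" using \<gamma> \<alpha> n by simp
  have "finite B" using B(2) by (rule finite_subset) simp
  then have "0 < sqrt (card B) * ?s"
    using B(1) s by (intro mult_pos_pos) (auto simp: card_gt_0_iff)
  then show "0 < ?\<delta>" by (simp add: less_max_iff_disj)
  have "private_risk 1 n d \<alpha> p0 ?\<delta> \<le> private_risk 2 n d \<alpha> p0 (1000 * ?s)"
    using alternatives_L1_subset_L2[OF p0 B s, of 1000] by (intro private_risk_antimono) simp
  also have "\<dots> \<le> ennreal \<gamma>"
    using private_risk_L2_le[OF \<gamma> n d p0 \<alpha>] by simp
  finally show "private_risk 1 n d \<alpha> p0 ?\<delta> \<le> ennreal \<gamma>" .
qed

text \<open>The tail beyond \<open>d\<close> is empty, so \<open>d\<close> itself is admissible and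
  \<open>Min\<close> is taken over a nonempty set.\<close>

lemma tail_index:
  assumes "1 \<le> d"
  shows "tail_index n d \<alpha> p0 \<in> {1..d}"
    and "(\<Sum>j\<in>{1..d} - {1..tail_index n d \<alpha> p0}. p0 j)
      \<le> sqrt (real (tail_index n d \<alpha> p0)) / sqrt (real n * \<alpha>\<^sup>2)"
proof -
  let ?J = "{j \<in> {1..d}. sqrt (real j) / sqrt (real n * \<alpha>\<^sup>2) \<ge> (\<Sum>j'=j+1..d. p0 j')}"
  have "d \<in> ?J" using assms by simp
  then have "Min ?J \<in> ?J" by (intro Min_in) auto
  then have J: "tail_index n d \<alpha> p0 \<in> ?J" unfolding tail_index_def .
  then show "tail_index n d \<alpha> p0 \<in> {1..d}" by simp
  then have "{1..d} - {1..tail_index n d \<alpha> p0} = {tail_index n d \<alpha> p0 + 1..d}" by auto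
  with J show "(\<Sum>j\<in>{1..d} - {1..tail_index n d \<alpha> p0}. p0 j)
      \<le> sqrt (real (tail_index n d \<alpha> p0)) / sqrt (real n * \<alpha>\<^sup>2)" by simp
qed

theorem theorem3:
  "(\<exists>C::real. C > 0 \<and>
      (\<forall>\<gamma>\<in>{0<..<1::real}. \<forall>n\<ge>1. \<forall>d\<ge>1. \<forall>p0\<in>prob_vectors d. \<forall>\<alpha>\<in>{0<..1::real}.
        \<forall>B. B \<noteq> {} \<and> B \<subseteq> {1..d} \<longrightarrow>
          testing_radius 1 n d \<alpha> \<gamma> p0
            \<le> C * max (sqrt (real (card B)) / sqrt (real n * \<alpha>\<^sup>2 * \<gamma>\<^sup>2)) (\<Sum>j\<in>{1..d} - B. p0 j) \<and>
          testing_radius 2 n d \<alpha> \<gamma> p0 \<le> C / sqrt (real n * \<alpha>\<^sup>2 * \<gamma>\<^sup>2))) \<and>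
   (\<forall>\<gamma>\<in>{0<..<1::real}. \<exists>C\<^sub>1::real.
      \<forall>n\<ge>1. \<forall>d\<ge>1. \<forall>p0\<in>prob_vectors d. \<forall>\<alpha>\<in>{0<..1::real}.
        testing_radius 1 n d \<alpha> \<gamma> p0
          \<le> C\<^sub>1 * (sqrt (real (tail_index n d \<alpha> p0)) / sqrt (real n * \<alpha>\<^sup>2)))"
proof (rule conjI)
  show "\<exists>C::real. C > 0 \<and>
      (\<forall>\<gamma>\<in>{0<..<1::real}. \<forall>n\<ge>1. \<forall>d\<ge>1. \<forall>p0\<in>prob_vectors d. \<forall>\<alpha>\<in>{0<..1::real}.
        \<forall>B. B \<noteq> {} \<and> B \<subseteq> {1..d} \<longrightarrow>
          testing_radius 1 n d \<alpha> \<gamma> p0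
            \<le> C * max (sqrt (real (card B)) / sqrt (real n * \<alpha>\<^sup>2 * \<gamma>\<^sup>2)) (\<Sum>j\<in>{1..d} - B. p0 j) \<and>
          testing_radius 2 n d \<alpha> \<gamma> p0 \<le> C / sqrt (real n * \<alpha>\<^sup>2 * \<gamma>\<^sup>2))"
  proof (intro conjI exI[of _ 4000] ballI allI impI)
    fix \<gamma> \<alpha> :: real and n d :: nat and p0 :: "nat \<Rightarrow> real" and B :: "nat set"
    assume h: "\<gamma> \<in> {0<..<1}" "1 \<le> n" "1 \<le> d" "p0 \<in> prob_vectors d" "\<alpha> \<in> {0<..1}"
      "B \<noteq> {} \<and> B \<subseteq> {1..d}"
    then show "testing_radius 1 n d \<alpha> \<gamma> p0
        \<le> 4000 * max (sqrt (real (card B)) / sqrt (real n * \<alpha>\<^sup>2 * \<gamma>\<^sup>2)) (\<Sum>j\<in>{1..d} - B. p0 j)"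
      by (intro testing_radius_L1_le) auto
    have pos: "0 < sqrt (real n * \<alpha>\<^sup>2 * \<gamma>\<^sup>2)" using h by simp
    have "testing_radius 2 n d \<alpha> \<gamma> p0 \<le> 1000 / sqrt (real n * \<alpha>\<^sup>2 * \<gamma>\<^sup>2)"
      using h pos by (intro testing_radius_le private_risk_L2_le) auto
    also have "\<dots> \<le> 4000 / sqrt (real n * \<alpha>\<^sup>2 * \<gamma>\<^sup>2)"
      using pos by (intro divide_right_mono) auto
    finally show "testing_radius 2 n d \<alpha> \<gamma> p0 \<le> 4000 / sqrt (real n * \<alpha>\<^sup>2 * \<gamma>\<^sup>2)" .
  qed simp
next
  show "\<forall>\<gamma>\<in>{0<..<1::real}. \<exists>C\<^sub>1::real.
      \<forall>n\<ge>1. \<forall>d\<ge>1. \<forall>p0\<in>prob_vectors d. \<forall>\<alpha>\<in>{0<..1::real}.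
        testing_radius 1 n d \<alpha> \<gamma> p0
          \<le> C\<^sub>1 * (sqrt (real (tail_index n d \<alpha> p0)) / sqrt (real n * \<alpha>\<^sup>2))"
  proof (rule ballI)
    fix \<gamma> :: real
    assume \<gamma>: "\<gamma> \<in> {0<..<1}"
    show "\<exists>C\<^sub>1::real. \<forall>n\<ge>1. \<forall>d\<ge>1. \<forall>p0\<in>prob_vectors d. \<forall>\<alpha>\<in>{0<..1::real}.
          testing_radius 1 n d \<alpha> \<gamma> p0
            \<le> C\<^sub>1 * (sqrt (real (tail_index n d \<alpha> p0)) / sqrt (real n * \<alpha>\<^sup>2))"
    \<comment> \<open>The first bound is used with \<open>B = {1..?j}\<close>; pulling \<gamma> out
      of the square root gives the factor 1/\<gamma>.\<close>
    proof (intro exI[of _ "4000 / \<gamma>"] ballI allI impI)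
      fix n d :: nat and p0 :: "nat \<Rightarrow> real" and \<alpha> :: real
      assume h: "1 \<le> n" "1 \<le> d" "p0 \<in> prob_vectors d" "\<alpha> \<in> {0<..1}"
      let ?j = "tail_index n d \<alpha> p0"
      let ?r = "sqrt (real ?j) / sqrt (real n * \<alpha>\<^sup>2)"
      note j = tail_index[OF h(2), where n = n and \<alpha> = \<alpha> and ?p0.0 = p0]
      have "testing_radius 1 n d \<alpha> \<gamma> p0 \<le> 4000 * max (sqrt (real (card {1..?j}))
          / sqrt (real n * \<alpha>\<^sup>2 * \<gamma>\<^sup>2)) (\<Sum>j\<in>{1..d} - {1..?j}. p0 j)"
        using \<gamma> h j(1) by (intro testing_radius_L1_le) auto
      also have "sqrt (real (card {1..?j})) / sqrt (real n * \<alpha>\<^sup>2 * \<gamma>\<^sup>2) = ?r / \<gamma>"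
        using \<gamma> by (simp add: real_sqrt_mult)
      \<comment> \<open>By the choice of \<open>tail_index\<close> the tail is at most
        \<open>?r\<close>, and \<gamma> < 1.\<close>
      also have "max (?r / \<gamma>) (\<Sum>j\<in>{1..d} - {1..?j}. p0 j) \<le> ?r / \<gamma>"
      proof -
        have "?r * \<gamma> \<le> ?r * 1" using \<gamma> by (intro mult_left_mono) auto
        then have "?r \<le> ?r / \<gamma>" using \<gamma> by (simp only: pos_le_divide_eq greaterThanLessThan_iff mult_1_right)
        then show ?thesis using j(2) by linarith
      qed
      finally show "testing_radius 1 n d \<alpha> \<gamma> p0 \<le> 4000 / \<gamma> * ?r" by (simp add: mult_ac)
    qed
  qed
qed

end
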